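(* Let the parameters be regular. Let $(\boldsymbol\nu,\boldsymbol\mu)\in\mathbb N_0^p\times\mathbb N_0^q$ with $|\boldsymbol\mu|=|\boldsymbol\nu|+1$ and $(\boldsymbol\lambda,\boldsymbol\eta)\in\mathbb N_0^p\times\mathbb N_0^q$ with $|\boldsymbol\lambda|=|\boldsymbol\eta|+1$, where $\boldsymbol\mu,\boldsymbol\eta$ are near the diagonal, and let the parameters be admissible for $\boldsymbol\mu$ and for $\boldsymbol\eta$. Then for $d\in\{0,1\}$, $$\mathscr P^{(\boldsymbol\lambda,\boldsymbol\eta)}_{d,(\boldsymbol\nu,\boldsymbol\mu)}=\big\langle z^d\mathbf B_{\boldsymbol\nu,\boldsymbol\mu},\mathbf A_{\boldsymbol\lambda,\boldsymbol\eta}\big\rangle ,$$ where $\mathscr P$ is the finite Gamma–Pochhammer pairing block, $\mathbf A,\mathbf B$ the normalized explicit vectors, and $\langle\cdot,\cdot\rangle$ the contour pairing, all defined in the context.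
   Context: Notation. $\mathbf 1_d$: all-ones vector; $\boldsymbol e_j$: standard basis vector; $|\boldsymbol n|=\sum n_i$; $\boldsymbol c^{*i}$: $\boldsymbol c$ with its $i$-th component removed. $(x)_n=\Gamma(x+n)/\Gamma(x)$ for $n\in\mathbb Z$ (so $(x)_{-n}=1/(x-n)_n$); for vectors $\Gamma(\boldsymbol v)=\prod_h\Gamma(v_h)$, $(\boldsymbol c)_{\boldsymbol m}=\prod_h(c_h)_{m_h}$, a scalar subscript is applied to each component; empty products are $1$. $\mathbb T$: positively oriented unit circle. $\mathbb Z_{\le0}=\{0,-1,\dots\}$. Parameters: $p,q\ge1$, $0\le r<q$, $\boldsymbol a\in\mathbb C^r$, $\boldsymbol b\in\mathbb C^q$, $\boldsymbol\kappa\in\mathbb C^p$; regular: $b_j-b_h\notin\mathbb Z$ $(j\ne h)$, $\kappa_i-\kappa_h\notin\mathbb Z$ $(i\ne h)$. Weights: $C_{j,i}(z)=\sum_{k\ge0}\frac{\Gamma((k+\kappa_i)\mathbf 1_r+\boldsymbol a+\mathbf 1_r)}{\Gamma((k+\kappa_i)\mathbf 1_q+\boldsymbol b+\boldsymbol e_j+\mathbf 1_q)}z^{-k-1}$. Pairing: $\langle\mathbf B,\mathbf A\rangle=\sum_{j,i}\oint_{\mathbb T}B^{(j)}(z)C_{j,i}(z)A^{(i)}(z)\frac{\mathrm dz}{2\pi\mathrm i}$. $\boldsymbol m\in\mathbb N_0^q$ near the diagonal: $|m_j-m_h|\le1$ for all $j,h$; $m_{\min}=\min_hm_h$, $j_{\min}=\min\{j:m_j=m_{\min}\}$,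 $m_{\max}=\max_hm_h$, $j_{\max}=\max\{j:m_j=m_{\max}\}$. Admissible for $\boldsymbol m$: for all $i,j,\rho$, $\kappa_i+a_\rho+1\notin\mathbb Z_{\le0}$, $\kappa_i+b_j+1\notin\mathbb Z_{\le0}$; $a_\rho-b_j-m_j+1\notin\mathbb Z_{\le0}$ whenever $m_j\ge1$; $a_\rho-b_{j_{\min}}-m_{\min}\notin\mathbb Z_{\le0}$. Normalized vectors. For $|\boldsymbol n|=|\boldsymbol m|+1$: $A^{(i)}_{\boldsymbol n,\boldsymbol m}=0$ if $n_i=0$, else $$A^{(i)}_{\boldsymbol n,\boldsymbol m}(z)=\nu^AC_{\boldsymbol n,\boldsymbol m;i}\sum_{k=0}^{n_i-1}\frac{(1-n_i)_k(\kappa_i\mathbf 1_q+\boldsymbol b+\boldsymbol m+\mathbf 1_q)_k(\kappa_i\mathbf 1_{p-1}-\boldsymbol\kappa^{*i}-\boldsymbol n^{*i}+\mathbf 1_{p-1})_k}{(\kappa_i\mathbf 1_r+\boldsymbol a+\mathbf 1_r)_k(\kappa_i\mathbf 1_{p-1}-\boldsymbol\kappa^{*i}+\mathbf 1_{p-1})_k}\frac{z^k}{k!},$$ $$C_{\boldsymbol n,\boldsymbol m;i}=(-1)^{|\boldsymbol n|}\frac{\Gamma(\kappa_i\mathbf 1_q+\boldsymbol b+\mathbf 1_q)}{\Gamma(\kappa_i\mathbf 1_r+\boldsymbol a+\mathbf 1_r)}\frac{\prod_j(\kappa_i+b_j+1)_{m_j}}{(-1)^{n_i-1}(n_i-1)!\prod_{\ell\ne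 i}(\kappa_i-\kappa_\ell-n_\ell+1)_{n_\ell}},$$ $$\nu^A=-\frac{\prod_i(\kappa_i+b_{j_{\min}}+m_{\min}+1)_{n_i}}{(\boldsymbol a-b_{j_{\min}}\mathbf 1_r-m_{\min}\mathbf 1_r)_{m_{\min}}\prod_{h:m_h=m_{\min}+1}(b_h-b_{j_{\min}})}.$$ For $|\boldsymbol m|=|\boldsymbol n|+1$: $B^{(j)}_{\boldsymbol n,\boldsymbol m}=0$ if $m_j=0$, else $$B^{(j)}_{\boldsymbol n,\boldsymbol m}(z)=\nu^B\Bigg[\pi_{j,0}+\frac{(\boldsymbol a-b_j\mathbf 1_r)_1}{(\boldsymbol b^{*j}-b_j\mathbf 1_{q-1})_1}\sum_{H=1}^q\sum_{K=1}^{m_H-1}\pi_{H,K}\frac{(\boldsymbol b^{*j}-(b_H+K)\mathbf 1_{q-1})_1}{(\boldsymbol a-(b_H+K)\mathbf 1_r)_1}\sum_{d=0}^{K-1+\delta_{j,H}}\frac{(\boldsymbol b-(b_H+K)\mathbf 1_q+\mathbf 1_q-\boldsymbol e_j)_d}{(\boldsymbol a-(b_H+K)\mathbf 1_r+\mathbf 1_r)_d}z^d\Bigg],$$ $$\pi_{H,K}=-\frac{\prod_i(\kappa_i+b_H+K+1)_{n_i}}{(-1)^KK!(m_H-K-1)!\prod_{I\ne H}(b_I-b_H-K)_{m_I}},$$ $$\nu^B=-\frac{(\boldsymbol a-b_{j_{\max}}\mathbf 1_r-(m_{\max}-1)\mathbf 1_r)_{m_{\max}}\prod_{h\ne j_{\max},m_h=m_{\max}}(b_h-b_{j_{\max}})}{(\boldsymbol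 a-b_{j_{\max}}\mathbf 1_r)_1\prod_i(\kappa_i+b_{j_{\max}}+m_{\max})_{n_i}}.$$ Pairing block. Put $\eta_-=\min_h\eta_h$, $j_-=\min\{h:\eta_h=\eta_-\}$, $\mu_+=\max_h\mu_h$, $j_+=\max\{h:\mu_h=\mu_+\}$, $K_+=\mu_+-1$, $$\mathcal N=\frac{(\boldsymbol\kappa+(b_{j_-}+\eta_-+1)\mathbf 1_p)_{\boldsymbol\lambda}\,(\boldsymbol a-(b_{j_+}+K_+)\mathbf 1_r)_{K_+}}{(\boldsymbol a-(b_{j_-}+\eta_-)\mathbf 1_r)_{\eta_-}\prod_{h:\eta_h=\eta_-+1}(b_h-b_{j_-})}\prod_{h\ne j_+,\,\mu_h=\mu_+}(b_h-b_{j_+}).$$ For $1\le i\le p$, $1\le j,H\le q$, $0\le\alpha\le\lambda_i-1$: if $H=j$, $0\le K\le\mu_H-1$, $0\le\beta\le K$, $$\begin{aligned}\mathcal S_{d;i,H,H,K}(\alpha,\beta)=&\frac{(-1)^{|\boldsymbol\lambda|-\lambda_i+\alpha+\beta-K}}{\alpha!(\lambda_i-1-\alpha)!(K-\beta)!(\mu_H-K-1)!}\\&\times\frac{(\kappa_i\mathbf 1_r+\boldsymbol a+(\alpha+1)\mathbf 1_r)_{d+\beta}\,(\boldsymbol a-(b_H+K)\mathbf 1_r+(\beta+1)\mathbf 1_r)_{K-\beta}}{(\kappa_i\mathbf 1_{p-1}-\boldsymbol\kappa^{*i}-\boldsymbol\lambda^{*i}+(\alpha+1)\mathbf 1_{p-1})_{\boldsymbol\lambda^{*i}}\,(\boldsymbol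 a-(b_H+K)\mathbf 1_r)_K}\cdot\frac{(\boldsymbol\kappa+(b_H+K+1)\mathbf 1_p)_{\boldsymbol\nu}}{(\boldsymbol\kappa+(b_{j_+}+K_++1)\mathbf 1_p)_{\boldsymbol\nu}}\\&\times\frac{(\kappa_i\mathbf 1_q+\boldsymbol b+(d+\alpha+\beta+1)\mathbf 1_q+\boldsymbol e_H)_{\boldsymbol\eta-(d+\beta)\mathbf 1_q-\boldsymbol e_H}}{(\boldsymbol b^{*H}-b_H\mathbf 1_{q-1})_1\,(\boldsymbol b^{*H}-(b_H+K)\mathbf 1_{q-1}+(\beta+1)\mathbf 1_{q-1})_{\boldsymbol\mu^{*H}-(\beta+1)\mathbf 1_{q-1}}};\end{aligned}$$ if $H\ne j$, $1\le K\le\mu_H-1$, $0\le\beta\le K-1$, $$\begin{aligned}\mathcal S_{d;i,j,H,K}(\alpha,\beta)=&\frac{(-1)^{|\boldsymbol\lambda|-\lambda_i+1+\alpha+K+\beta}}{\alpha!(\lambda_i-1-\alpha)!(K-1-\beta)!(\mu_H-K-1)!}\\&\times\frac{(\boldsymbol a-b_j\mathbf 1_r)_1\,(\kappa_i\mathbf 1_r+\boldsymbol a+(\alpha+1)\mathbf 1_r)_{d+\beta}}{(\kappa_i\mathbf 1_{p-1}-\boldsymbol\kappa^{*i}-\boldsymbol\lambda^{*i}+(\alpha+1)\mathbf 1_{p-1})_{\boldsymbol\lambda^{*i}}\,(\boldsymbol a-(b_H+K)\mathbf 1_r)_{\beta+1}}\cdot\frac{(\boldsymbol\kappa+(b_H+K+1)\mathbf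 1_p)_{\boldsymbol\nu}}{(\boldsymbol\kappa+(b_{j_+}+K_++1)\mathbf 1_p)_{\boldsymbol\nu}}\\&\times\frac{(\kappa_i\mathbf 1_q+\boldsymbol b+(d+\alpha+\beta+1)\mathbf 1_q+\boldsymbol e_j)_{\boldsymbol\eta-(d+\beta)\mathbf 1_q-\boldsymbol e_j}}{(\boldsymbol b^{*j}-b_j\mathbf 1_{q-1})_1\,(\boldsymbol b^{*H}-(b_H+K)\mathbf 1_{q-1}+(\beta+1)\mathbf 1_{q-1}-\boldsymbol e_j^{*H})_{\boldsymbol\mu^{*H}-(\beta+1)\mathbf 1_{q-1}+\boldsymbol e_j^{*H}}};\end{aligned}$$ and $\mathcal S=0$ in all other cases. Finally $$\mathscr P^{(\boldsymbol\lambda,\boldsymbol\eta)}_{d,(\boldsymbol\nu,\boldsymbol\mu)}=\mathcal N\sum_{j=1}^q\sum_{i=1}^p\sum_{\beta=0}^{\mu_j-1}\sum_{\alpha=0}^{\lambda_i-1}\sum_{H=1}^q\sum_{K=0}^{\mu_H-1}\mathcal S_{d;i,j,H,K}(\alpha,\beta).$$ *)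

theory Defs
  imports "HOL-Complex_Analysis.Complex_Analysis"
begin

text \<open>
  Vectors are functions on \<open>nat\<close>, of which only the components with indices in \<open>{1..p}\<close>,
  \<open>{1..q}\<close> or \<open>{1..r}\<close> are ever used; \<open>of_bool (h = j)\<close> is the \<open>h\<close>-th component of the basis
  vector \<open>e\<^sub>j\<close>, and a product over \<open>{1..p} - {i}\<close> is one in which the \<open>i\<close>-th component is removed.
\<close>

text \<open>
  The symbol \<open>(x)\<^sub>n = \<Gamma>(x + n) / \<Gamma>(x)\<close> for integer \<open>n\<close>. For natural \<open>n\<close> it is the library's
  \<^const>\<open>pochhammer\<close>, which extends the quotient to the poles, as is needed
  for \<open>(1 - n\<^sub>i)\<^sub>k\<close>.
\<close>

definition ipoch :: "complex \<Rightarrow> int \<Rightarrow> complex" where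
  "ipoch x n = (if n \<ge> 0 then pochhammer x (nat n)
                else 1 / pochhammer (x + of_int n) (nat (- n)))"

lemma ipoch_of_nat: "ipoch x (int n) = pochhammer x n"
  by (simp add: ipoch_def)

lemma ipoch_Gamma:
  assumes "x \<notin> \<int>\<^sub>\<le>\<^sub>0" "x + of_int n \<notin> \<int>\<^sub>\<le>\<^sub>0"
  shows "ipoch x n = Gamma (x + of_int n) / Gamma x"
proof (cases "n \<ge> 0")
  case True
  then show ?thesis
    using assms(1) by (simp add: ipoch_def pochhammer_Gamma)
next
  case False
  then show ?thesis
    using assms(2) by (simp add: ipoch_def pochhammer_Gamma)
qed

definition near_diagonal :: "nat \<Rightarrow> (nat \<Rightarrow> nat) \<Rightarrow> bool" where
  "near_diagonal q m \<longleftrightarrow> (\<forall>j\<in>{1..q}. \<forall>h\<in>{1..q}. \<bar>int (m j) - int (m h)\<bar> \<le> 1)"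

definition vmin :: "nat \<Rightarrow> (nat \<Rightarrow> nat) \<Rightarrow> nat" where
  "vmin q m = Min (m ` {1..q})"

definition jmin :: "nat \<Rightarrow> (nat \<Rightarrow> nat) \<Rightarrow> nat" where
  "jmin q m = Min {j \<in> {1..q}. m j = vmin q m}"

definition vmax :: "nat \<Rightarrow> (nat \<Rightarrow> nat) \<Rightarrow> nat" where
  "vmax q m = Max (m ` {1..q})"

definition jmax :: "nat \<Rightarrow> (nat \<Rightarrow> nat) \<Rightarrow> nat" where
  "jmax q m = Min {j \<in> {1..q}. m j = vmax q m}"

context
  fixes p q r :: nat and a b \<kappa> :: "nat \<Rightarrow> complex"
begin

definition regular :: bool where
  "regular \<longleftrightarrow>
     (\<forall>j\<in>{1..q}. \<forall>h\<in>{1..q}. j \<noteq> h \<longrightarrow> b j - b h \<notin> \<int>) \<and>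
     (\<forall>i\<in>{1..p}. \<forall>h\<in>{1..p}. i \<noteq> h \<longrightarrow> \<kappa> i - \<kappa> h \<notin> \<int>)"

definition admissible :: "(nat \<Rightarrow> nat) \<Rightarrow> bool" where
  "admissible m \<longleftrightarrow>
     (\<forall>i\<in>{1..p}. \<forall>\<rho>\<in>{1..r}. \<kappa> i + a \<rho> + 1 \<notin> \<int>\<^sub>\<le>\<^sub>0) \<and>
     (\<forall>i\<in>{1..p}. \<forall>j\<in>{1..q}. \<kappa> i + b j + 1 \<notin> \<int>\<^sub>\<le>\<^sub>0) \<and>
     (\<forall>j\<in>{1..q}. \<forall>\<rho>\<in>{1..r}. m j \<ge> 1 \<longrightarrow> a \<rho> - b j - of_nat (m j) + 1 \<notin> \<int>\<^sub>\<le>\<^sub>0) \<and>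
     (\<forall>\<rho>\<in>{1..r}. a \<rho> - b (jmin q m) - of_nat (vmin q m) \<notin> \<int>\<^sub>\<le>\<^sub>0)"

definition weight :: "nat \<Rightarrow> nat \<Rightarrow> complex \<Rightarrow> complex" where
  "weight j i z =
     (\<Sum>k. (\<Prod>\<rho>=1..r. Gamma (of_nat k + \<kappa> i + a \<rho> + 1)) /
           (\<Prod>h=1..q. Gamma (of_nat k + \<kappa> i + b h + of_bool (h = j) + 1)) *
           z powi (- int k - 1))"

definition pairing ::
    "(nat \<Rightarrow> complex \<Rightarrow> complex) \<Rightarrow> (nat \<Rightarrow> complex \<Rightarrow> complex) \<Rightarrow> complex" where
  "pairing B A =
     (\<Sum>j=1..q. \<Sum>i=1..p.
        contour_integral (circlepath 0 1) (\<lambda>z. B j z * weight j i z * A i z) / (2 * of_real pi * \<i>))"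

definition nuA :: "(nat \<Rightarrow> nat) \<Rightarrow> (nat \<Rightarrow> nat) \<Rightarrow> complex" where
  "nuA n m =
     - (\<Prod>i=1..p. pochhammer (\<kappa> i + b (jmin q m) + of_nat (vmin q m) + 1) (n i)) /
       ((\<Prod>\<rho>=1..r. pochhammer (a \<rho> - b (jmin q m) - of_nat (vmin q m)) (vmin q m)) *
        (\<Prod>h | h \<in> {1..q} \<and> m h = vmin q m + 1. b h - b (jmin q m)))"

definition coefA :: "(nat \<Rightarrow> nat) \<Rightarrow> (nat \<Rightarrow> nat) \<Rightarrow> nat \<Rightarrow> complex" where
  "coefA n m i =
     (- 1) ^ (\<Sum>l=1..p. n l) *
     ((\<Prod>j=1..q. Gamma (\<kappa> i + b j + 1)) / (\<Prod>\<rho>=1..r. Gamma (\<kappa> i + a \<rho> + 1))) *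
     ((\<Prod>j=1..q. pochhammer (\<kappa> i + b j + 1) (m j)) /
      ((- 1) ^ (n i - 1) * fact (n i - 1) *
       (\<Prod>l\<in>{1..p} - {i}. pochhammer (\<kappa> i - \<kappa> l - of_nat (n l) + 1) (n l))))"

definition vecA :: "(nat \<Rightarrow> nat) \<Rightarrow> (nat \<Rightarrow> nat) \<Rightarrow> nat \<Rightarrow> complex \<Rightarrow> complex" where
  "vecA n m i z =
     (if n i = 0 then 0 else
      nuA n m * coefA n m i *
      (\<Sum>k=0..n i - 1.
         (pochhammer (1 - of_nat (n i)) k *
          (\<Prod>h=1..q. pochhammer (\<kappa> i + b h + of_nat (m h) + 1) k) *
          (\<Prod>l\<in>{1..p} - {i}. pochhammer (\<kappa> i - \<kappa> l - of_nat (n l) + 1) k)) /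
         ((\<Prod>\<rho>=1..r. pochhammer (\<kappa> i + a \<rho> + 1) k) *
          (\<Prod>l\<in>{1..p} - {i}. pochhammer (\<kappa> i - \<kappa> l + 1) k)) *
         (z ^ k / fact k)))"

definition piB :: "(nat \<Rightarrow> nat) \<Rightarrow> (nat \<Rightarrow> nat) \<Rightarrow> nat \<Rightarrow> nat \<Rightarrow> complex" where
  "piB n m H K =
     - (\<Prod>i=1..p. pochhammer (\<kappa> i + b H + of_nat K + 1) (n i)) /
       ((- 1) ^ K * fact K * fact (m H - K - 1) *
        (\<Prod>I\<in>{1..q} - {H}. pochhammer (b I - b H - of_nat K) (m I)))"

definition nuB :: "(nat \<Rightarrow> nat) \<Rightarrow> (nat \<Rightarrow> nat) \<Rightarrow> complex" where
  "nuB n m =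
     - ((\<Prod>\<rho>=1..r. pochhammer (a \<rho> - b (jmax q m) - (of_nat (vmax q m) - 1)) (vmax q m)) *
        (\<Prod>h | h \<in> {1..q} \<and> h \<noteq> jmax q m \<and> m h = vmax q m. b h - b (jmax q m))) /
       ((\<Prod>\<rho>=1..r. pochhammer (a \<rho> - b (jmax q m)) 1) *
        (\<Prod>i=1..p. pochhammer (\<kappa> i + b (jmax q m) + of_nat (vmax q m)) (n i)))"

definition vecB :: "(nat \<Rightarrow> nat) \<Rightarrow> (nat \<Rightarrow> nat) \<Rightarrow> nat \<Rightarrow> complex \<Rightarrow> complex" where
  "vecB n m j z =
     (if m j = 0 then 0 else
      nuB n m *
      (piB n m j 0 +
       (\<Prod>\<rho>=1..r. pochhammer (a \<rho> - b j) 1) / (\<Prod>h\<in>{1..q} - {j}. pochhammer (b h - b j) 1) *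
       (\<Sum>H=1..q. \<Sum>K=1..m H - 1.
          piB n m H K *
          ((\<Prod>h\<in>{1..q} - {j}. pochhammer (b h - (b H + of_nat K)) 1) /
           (\<Prod>\<rho>=1..r. pochhammer (a \<rho> - (b H + of_nat K)) 1)) *
          (\<Sum>d=0..K - 1 + of_bool (j = H).
             (\<Prod>h=1..q. pochhammer (b h - (b H + of_nat K) + 1 - of_bool (h = j)) d) /
             (\<Prod>\<rho>=1..r. pochhammer (a \<rho> - (b H + of_nat K) + 1) d) * z ^ d))))"

definition blockN ::
    "(nat \<Rightarrow> nat) \<Rightarrow> (nat \<Rightarrow> nat) \<Rightarrow> (nat \<Rightarrow> nat) \<Rightarrow> complex" where
  "blockN lam \<eta> \<mu> =
     (let Kp = vmax q \<mu> - 1 in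
      ((\<Prod>i=1..p. pochhammer (\<kappa> i + (b (jmin q \<eta>) + of_nat (vmin q \<eta>) + 1)) (lam i)) *
       (\<Prod>\<rho>=1..r. pochhammer (a \<rho> - (b (jmax q \<mu>) + of_nat Kp)) Kp)) /
      ((\<Prod>\<rho>=1..r. pochhammer (a \<rho> - (b (jmin q \<eta>) + of_nat (vmin q \<eta>))) (vmin q \<eta>)) *
       (\<Prod>h | h \<in> {1..q} \<and> \<eta> h = vmin q \<eta> + 1. b h - b (jmin q \<eta>))) *
      (\<Prod>h | h \<in> {1..q} \<and> h \<noteq> jmax q \<mu> \<and> \<mu> h = vmax q \<mu>. b h - b (jmax q \<mu>)))"

definition nu_ratio :: "(nat \<Rightarrow> nat) \<Rightarrow> (nat \<Rightarrow> nat) \<Rightarrow> nat \<Rightarrow> nat \<Rightarrow> complex" where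
  "nu_ratio \<nu> \<mu> H K =
     (let Kp = vmax q \<mu> - 1 in
      (\<Prod>l=1..p. pochhammer (\<kappa> l + (b H + of_nat K + 1)) (\<nu> l)) /
      (\<Prod>l=1..p. pochhammer (\<kappa> l + (b (jmax q \<mu>) + of_nat Kp + 1)) (\<nu> l)))"

definition blockS_diag ::
    "(nat \<Rightarrow> nat) \<Rightarrow> (nat \<Rightarrow> nat) \<Rightarrow> (nat \<Rightarrow> nat) \<Rightarrow> (nat \<Rightarrow> nat) \<Rightarrow>
     nat \<Rightarrow> nat \<Rightarrow> nat \<Rightarrow> nat \<Rightarrow> nat \<Rightarrow> nat \<Rightarrow> complex" where
  "blockS_diag lam \<eta> \<nu> \<mu> d i H K \<alpha> \<beta> =
     (- 1) powi ((\<Sum>l=1..p. int (lam l)) - int (lam i) + int \<alpha> + int \<beta> - int K) /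
       (fact \<alpha> * fact (lam i - 1 - \<alpha>) * fact (K - \<beta>) * fact (\<mu> H - K - 1)) *
     (((\<Prod>\<rho>=1..r. pochhammer (\<kappa> i + a \<rho> + (of_nat \<alpha> + 1)) (d + \<beta>)) *
       (\<Prod>\<rho>=1..r. pochhammer (a \<rho> - (b H + of_nat K) + (of_nat \<beta> + 1)) (K - \<beta>))) /
      ((\<Prod>l\<in>{1..p} - {i}. pochhammer (\<kappa> i - \<kappa> l - of_nat (lam l) + (of_nat \<alpha> + 1)) (lam l)) *
       (\<Prod>\<rho>=1..r. pochhammer (a \<rho> - (b H + of_nat K)) K))) *
     nu_ratio \<nu> \<mu> H K *
     ((\<Prod>h=1..q. ipoch (\<kappa> i + b h + (of_nat d + of_nat \<alpha> + of_nat \<beta> + 1) + of_bool (h = H))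
                       (int (\<eta> h) - (int d + int \<beta>) - of_bool (h = H))) /
      ((\<Prod>h\<in>{1..q} - {H}. pochhammer (b h - b H) 1) *
       (\<Prod>h\<in>{1..q} - {H}. ipoch (b h - (b H + of_nat K) + (of_nat \<beta> + 1))
                                 (int (\<mu> h) - (int \<beta> + 1)))))"

definition blockS_off ::
    "(nat \<Rightarrow> nat) \<Rightarrow> (nat \<Rightarrow> nat) \<Rightarrow> (nat \<Rightarrow> nat) \<Rightarrow> (nat \<Rightarrow> nat) \<Rightarrow>
     nat \<Rightarrow> nat \<Rightarrow> nat \<Rightarrow> nat \<Rightarrow> nat \<Rightarrow> nat \<Rightarrow> nat \<Rightarrow> complex" where
  "blockS_off lam \<eta> \<nu> \<mu> d i j H K \<alpha> \<beta> =
     (- 1) powi ((\<Sum>l=1..p. int (lam l)) - int (lam i) + 1 + int \<alpha> + int K + int \<beta>) /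
       (fact \<alpha> * fact (lam i - 1 - \<alpha>) * fact (K - 1 - \<beta>) * fact (\<mu> H - K - 1)) *
     (((\<Prod>\<rho>=1..r. pochhammer (a \<rho> - b j) 1) *
       (\<Prod>\<rho>=1..r. pochhammer (\<kappa> i + a \<rho> + (of_nat \<alpha> + 1)) (d + \<beta>))) /
      ((\<Prod>l\<in>{1..p} - {i}. pochhammer (\<kappa> i - \<kappa> l - of_nat (lam l) + (of_nat \<alpha> + 1)) (lam l)) *
       (\<Prod>\<rho>=1..r. pochhammer (a \<rho> - (b H + of_nat K)) (\<beta> + 1)))) *
     nu_ratio \<nu> \<mu> H K *
     ((\<Prod>h=1..q. ipoch (\<kappa> i + b h + (of_nat d + of_nat \<alpha> + of_nat \<beta> + 1) + of_bool (h = j))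
                       (int (\<eta> h) - (int d + int \<beta>) - of_bool (h = j))) /
      ((\<Prod>h\<in>{1..q} - {j}. pochhammer (b h - b j) 1) *
       (\<Prod>h\<in>{1..q} - {H}.
          ipoch (b h - (b H + of_nat K) + (of_nat \<beta> + 1) - of_bool (h = j))
                (int (\<mu> h) - (int \<beta> + 1) + of_bool (h = j)))))"

text \<open>The bounds are strict (\<open>K < \<mu> H\<close> for \<open>K \<le> \<mu>\<^sub>H - 1\<close>, etc.) so that truncated subtraction on
  \<open>nat\<close> cannot admit an index when the upper bound is \<open>-1\<close>.\<close>

definition blockS ::
    "(nat \<Rightarrow> nat) \<Rightarrow> (nat \<Rightarrow> nat) \<Rightarrow> (nat \<Rightarrow> nat) \<Rightarrow> (nat \<Rightarrow> nat) \<Rightarrow>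
     nat \<Rightarrow> nat \<Rightarrow> nat \<Rightarrow> nat \<Rightarrow> nat \<Rightarrow> nat \<Rightarrow> nat \<Rightarrow> complex" where
  "blockS lam \<eta> \<nu> \<mu> d i j H K \<alpha> \<beta> =
     (if H = j \<and> \<alpha> < lam i \<and> K < \<mu> H \<and> \<beta> \<le> K
        then blockS_diag lam \<eta> \<nu> \<mu> d i H K \<alpha> \<beta>
      else if H \<noteq> j \<and> \<alpha> < lam i \<and> 1 \<le> K \<and> K < \<mu> H \<and> \<beta> < K
        then blockS_off lam \<eta> \<nu> \<mu> d i j H K \<alpha> \<beta>
      else 0)"

definition pairing_block ::
    "(nat \<Rightarrow> nat) \<Rightarrow> (nat \<Rightarrow> nat) \<Rightarrow> (nat \<Rightarrow> nat) \<Rightarrow> (nat \<Rightarrow> nat) \<Rightarrow> nat \<Rightarrow> complex" where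
  "pairing_block lam \<eta> \<nu> \<mu> d =
     blockN lam \<eta> \<mu> *
     (\<Sum>j=1..q. \<Sum>i=1..p. \<Sum>\<beta><\<mu> j. \<Sum>\<alpha><lam i. \<Sum>H=1..q. \<Sum>K<\<mu> H.
        blockS lam \<eta> \<nu> \<mu> d i j H K \<alpha> \<beta>)"

end

end

theory Submission
  imports Defs
begin

text \<open>
  Since \<open>r < q\<close>, the weight \<open>C\<^sub>j\<^sub>,\<^sub>i\<close> is a Laurent series that converges uniformly on the unit circle, so
  the contour integral against \<open>z\<^sup>k\<close> extracts its \<open>k\<close>-th moment, a quotient of Gamma products. The
  vectors are polynomials; in the second one the separate term \<open>\<pi>\<^sub>j\<^sub>,\<^sub>0\<close> is the instance
  \<open>H = j\<close>, \<open>K = 0\<close> of the general summand, and near-diagonality bounds its degree. Expanding the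
  pairing gives a sum over the same indices as the block, and the two sums agree term by term
  by cancelling Pochhammer symbols; regularity and admissibility exclude the zeros and poles.
\<close>

subsection \<open>Pochhammer symbols\<close>

text \<open>Both signs of the subscript come from (x)_m = (x)_n (x+n)_{m-n}, read from left to right
  or with n and m exchanged. The symbols of the block may have negative subscripts, those in the
  vectors cannot; this identity converts between them.\<close>

lemma ipoch_quotient:
  assumes "pochhammer x n \<noteq> 0" "pochhammer x m \<noteq> 0"
  shows "ipoch (x + of_nat n) (int m - int n) = pochhammer x m / pochhammer x n"
proof (cases "n \<le> m")
  case True
  then show ?thesis
    using assms(1) pochhammer_product[of n m x] by (simp add: ipoch_def nat_diff_distrib)
next
  case False
  then have "x + of_nat n + of_int (int m - int n) = x + of_nat m" "nat (- (int m - int n)) = n - m"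
    by auto
  then show ?thesis
    using False assms pochhammer_product[of m n x] by (auto simp: ipoch_def)
qed

text \<open>Up to sign, (-K)_m is the falling factorial K(K-1)...(K-m+1). The factorials of
  differences in the block arise this way, from (1 - n_i)_k and from the component H, in which the
  entries of \<open>b\<close> cancel.\<close>

lemma pochhammer_uminus_of_nat:
  assumes "m \<le> K"
  shows "pochhammer (- of_nat K) m = ((- 1) ^ m * fact K / fact (K - m) :: 'a :: field_char_0)"
proof -
  have "pochhammer (of_nat K - of_nat m + 1) m * fact (K - m) = (fact K :: 'a)"
    using assms pochhammer_product'[of "1 :: 'a" "K - m" m]
    by (simp add: pochhammer_fact of_nat_diff algebra_simps)
  then show ?thesis
    by (simp add: pochhammer_minus field_simps)
qed

text \<open>Both (x)_n (x+n)_k and (x)_k (x+k)_n are equal to (x)_{n+k}.\<close>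

lemma pochhammer_shift_quotient:
  fixes x :: "'a :: field_char_0"
  assumes "pochhammer x n \<noteq> 0" "pochhammer (x + of_nat n) k \<noteq> 0" "pochhammer x k \<noteq> 0"
  shows "pochhammer x k / (pochhammer x n * pochhammer (x + of_nat n) k) =
         1 / pochhammer (x + of_nat k) n"
  using assms pochhammer_product'[of x n k] pochhammer_product'[of x k n]
  by (cases "pochhammer (x + of_nat k) n = 0") (auto simp: field_simps)

lemma pochhammer_nonzero_Ints:
  assumes "x \<notin> \<int>"
  shows "pochhammer (x :: 'a :: field_char_0) n \<noteq> 0"
  using assms by (auto simp: pochhammer_eq_0_iff)

lemma pochhammer_nonzero_nonpos_Ints:
  assumes "x \<notin> \<int>\<^sub>\<le>\<^sub>0"
  shows "pochhammer (x :: 'a :: field_char_0) n \<noteq> 0"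
  using assms by (auto simp: pochhammer_eq_0_iff)

lemma add_of_nat_nonpos_Ints:
  assumes "(x :: complex) \<notin> \<int>\<^sub>\<le>\<^sub>0"
  shows "x + of_nat n \<notin> \<int>\<^sub>\<le>\<^sub>0"
proof
  assume "x + of_nat n \<in> \<int>\<^sub>\<le>\<^sub>0"
  then have "x + of_nat n - of_nat n \<in> \<int>\<^sub>\<le>\<^sub>0" by (rule nonpos_Ints_diff_Nats) simp
  then show False using assms by simp
qed

subsection \<open>Contour integrals of Laurent series\<close>

text \<open>This is Cauchy's formula for the k-th derivative of z^n at 0, a derivative that is k!
  for n = k and zero otherwise.\<close>

lemma has_contour_integral_power_quotient:
  "((\<lambda>z. z ^ n / z ^ Suc k) has_contour_integral (if n = k then 2 * of_real pi * \<i> else 0))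
     (circlepath 0 1)"
proof -
  have "((\<lambda>z. z ^ n / (z - 0) ^ Suc k) has_contour_integral
          ((2 * pi * \<i>) / fact k * (deriv ^^ k) (\<lambda>z. z ^ n) 0)) (circlepath 0 1)"
    by (rule Cauchy_has_contour_integral_higher_derivative_circlepath)
       (auto intro!: continuous_intros holomorphic_intros)
  moreover have "(deriv ^^ k) (\<lambda>z. z ^ n) 0 = (if n = k then fact k else 0 :: complex)"
    using higher_deriv_power[of k 0 n 0]
    by (cases "n < k") (auto simp: pochhammer_0_left pochhammer_fact not_less)
  ultimately show ?thesis
    by (auto split: if_splits)
qed

text \<open>On the unit circle all powers of z have modulus 1, so absolute summability of the
  coefficients gives uniform convergence by the Weierstrass test. Integration is then termwise, and
  orthogonality leaves the term k = n.\<close>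

lemma has_contour_integral_Laurent:
  fixes W :: "nat \<Rightarrow> complex"
  assumes "summable (\<lambda>k. norm (W k))"
  shows "((\<lambda>z. z ^ n * (\<Sum>k. W k * z powi (- int k - 1))) has_contour_integral
           2 * of_real pi * \<i> * W n) (circlepath 0 1)"
proof -
  define f where "f = (\<lambda>k z. W k * (z ^ n / z ^ Suc k))"
  define F where "F = (\<lambda>N z. \<Sum>k<N. f k z)"
  define L where "L = (\<lambda>z. \<Sum>k. f k z)"
  have L: "z ^ n * (\<Sum>k. W k * z powi (- int k - 1)) = L z" if "norm z = 1" for z
  proof -
    have eq: "z powi (- int k - 1) = 1 / z ^ Suc k" for k
    proof -
      have "- int k - 1 = - int (Suc k)" by simp
      then show ?thesis by (simp only: power_int_minus power_int_of_nat inverse_eq_divide)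
    qed
    have "summable (\<lambda>k. norm (W k * z powi (- int k - 1)))"
      using assms that by (simp add: norm_mult norm_power_int)
    then have "summable (\<lambda>k. W k * z powi (- int k - 1))" by (rule summable_norm_cancel)
    then have "z ^ n * (\<Sum>k. W k * z powi (- int k - 1)) = (\<Sum>k. z ^ n * (W k * z powi (- int k - 1)))"
      by (rule suminf_mult[symmetric])
    then show ?thesis by (simp add: L_def f_def eq mult_ac del: power_Suc)
  qed
  have int: "(F N has_contour_integral (\<Sum>k<N. W k * (if n = k then 2 * of_real pi * \<i> else 0)))
          (circlepath 0 1)" for N
    unfolding F_def f_def
    by (intro has_contour_integral_sum has_contour_integral_lmul has_contour_integral_power_quotient) auto
  have int': "(F N has_contour_integral (if n < N then 2 * of_real pi * \<i> * W n else 0))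
          (circlepath 0 1)" for N
    using int[of N] by (auto simp: if_distrib sum.delta mult_ac cong: if_cong split: if_splits)
  have ul: "uniform_limit (sphere 0 1) F L sequentially"
    unfolding F_def L_def
    by (rule Weierstrass_m_test[OF _ assms]) (auto simp: f_def norm_mult norm_divide norm_power)
  have ev: "\<forall>\<^sub>F N in sequentially. F N contour_integrable_on circlepath 0 1"
    unfolding contour_integrable_on_def using int' by (intro always_eventually) blast
  have "L contour_integrable_on circlepath 0 1"
    by (rule contour_integral_uniform_limit_circlepath(1)[OF ev ul]) auto
  moreover have "(\<lambda>N. contour_integral (circlepath 0 1) (F N)) \<longlonglongrightarrow> contour_integral (circlepath 0 1) L"
    by (rule contour_integral_uniform_limit_circlepath(2)[OF ev ul]) auto
  \<comment> \<open>The integrals of the partial sums are constant from N = n + 1 on, where the term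
    k = n is included.\<close>
  moreover have "(\<lambda>N. contour_integral (circlepath 0 1) (F N)) \<longlonglongrightarrow> 2 * of_real pi * \<i> * W n"
    by (rule tendsto_eventually)
       (auto simp: contour_integral_unique[OF int'] eventually_sequentially intro!: exI[of _ "Suc n"])
  ultimately have "(L has_contour_integral 2 * of_real pi * \<i> * W n) (circlepath 0 1)"
    by (metis LIMSEQ_unique has_contour_integral_integral)
  \<comment> \<open>The series was rewritten only for \<open>norm z = 1\<close>; agreement on the
    path is enough for the integral.\<close>
  then show ?thesis
    by (rule has_contour_integral_eq) (auto simp: L path_image_circlepath)
qed

section \<open>Absolute summability of the weights on the unit circle\<close>

lemma tendsto_of_nat_add_quotient:
  fixes x y :: complex
  assumes "y \<notin> \<int>\<^sub>\<le>\<^sub>0"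
  shows "(\<lambda>n. (of_nat n + x) / (of_nat n + y)) \<longlonglongrightarrow> 1"
    and "(\<lambda>n. 1 / (of_nat n + y)) \<longlonglongrightarrow> 0"
proof -
  have nz: "of_nat n + y \<noteq> 0" for n
    using add_of_nat_nonpos_Ints[OF assms, of n] by (auto simp: add.commute)
  have "filterlim (\<lambda>n. of_nat n + y) at_infinity sequentially"
    by (rule tendsto_add_filterlim_at_infinity') (auto intro: tendsto_of_nat)
  then show inv: "(\<lambda>n. 1 / (of_nat n + y)) \<longlonglongrightarrow> 0"
    using filterlim_compose[OF tendsto_inverse_0] by (simp add: inverse_eq_divide)
  \<comment> \<open>The quotient is written as 1 + (x-y)/(n+y), which reduces its limit to the
    second claim.\<close>
  have "(\<lambda>n. 1 + (x - y) * (1 / (of_nat n + y))) \<longlonglongrightarrow> 1 + (x - y) * 0"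
    by (intro tendsto_intros inv)
  then show "(\<lambda>n. (of_nat n + x) / (of_nat n + y)) \<longlonglongrightarrow> 1"
    using nz by (simp add: field_simps)
qed

text \<open>By the recurrence of Gamma the ratio of consecutive terms is a rational function of k
  with r linear factors above and q > r below. It tends to 0, so the ratio test applies.\<close>

lemma summable_Gamma_quotient:
  fixes x y :: "nat \<Rightarrow> complex"
  assumes "r < q" and x: "\<And>\<rho>. \<rho> \<in> {1..r} \<Longrightarrow> x \<rho> \<notin> \<int>\<^sub>\<le>\<^sub>0" and y: "\<And>h. h \<in> {1..q} \<Longrightarrow> y h \<notin> \<int>\<^sub>\<le>\<^sub>0"
  shows "summable (\<lambda>k. norm ((\<Prod>\<rho>=1..r. Gamma (of_nat k + x \<rho>)) / (\<Prod>h=1..q. Gamma (of_nat k + y h))))"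
    (is "summable (\<lambda>k. norm (?W k))")
proof -
  \<comment> \<open>The r numerators are paired with the first r denominators. The factor h = q
    stays unpaired since r < q, and it forces the limit 0.\<close>
  define R where "R = (\<lambda>k. \<Prod>h=1..q. if h \<le> r then (of_nat k + x h) / (of_nat k + y h) else 1 / (of_nat k + y h))"
  have "R \<longlonglongrightarrow> (\<Prod>h=1..q. if h \<le> r then 1 else 0)"
    unfolding R_def
  proof (rule tendsto_prod)
    fix h assume "h \<in> {1..q}"
    then show "(\<lambda>k. if h \<le> r then (of_nat k + x h) / (of_nat k + y h) else 1 / (of_nat k + y h))
                 \<longlonglongrightarrow> (if h \<le> r then 1 else 0)"
      using tendsto_of_nat_add_quotient[OF y] by (cases "h \<le> r") simp_all
  qed
  also have "(\<Prod>h=1..q. if h \<le> r then 1 else 0) = (0 :: complex)"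
    using \<open>r < q\<close> by (auto intro!: bexI[of _ q])
  finally have "eventually (\<lambda>k. norm (R k) < 1 / 2) sequentially"
    using tendstoD[of R 0 sequentially "1/2"] by (simp add: dist_norm)
  then obtain N where N: "\<And>k. k \<ge> N \<Longrightarrow> norm (R k) < 1 / 2"
    by (auto simp: eventually_sequentially)
  have step: "?W (Suc k) = R k * ?W k" for k
  proof -
    have Gx: "Gamma (of_nat (Suc k) + x \<rho>) = (of_nat k + x \<rho>) * Gamma (of_nat k + x \<rho>)" if "\<rho> \<in> {1..r}" for \<rho>
      using Gamma_plus1[OF add_of_nat_nonpos_Ints[OF x[OF that], of k]] by (simp add: add_ac)
    have Gy: "Gamma (of_nat (Suc k) + y h) = (of_nat k + y h) * Gamma (of_nat k + y h)" if "h \<in> {1..q}" for h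
      using Gamma_plus1[OF add_of_nat_nonpos_Ints[OF y[OF that], of k]] by (simp add: add_ac)
    have "(\<Prod>h=1..q. if h \<le> r then of_nat k + x h else 1) = (\<Prod>\<rho>=1..r. of_nat k + x \<rho>)"
      using \<open>r < q\<close> by (intro prod.mono_neutral_cong_right) auto
    moreover have "R k = (\<Prod>h=1..q. (if h \<le> r then of_nat k + x h else 1) / (of_nat k + y h))"
      unfolding R_def by (intro prod.cong) auto
    ultimately have R: "R k = (\<Prod>\<rho>=1..r. of_nat k + x \<rho>) / (\<Prod>h=1..q. of_nat k + y h)"
      by (simp only: prod_dividef)
    show ?thesis
      by (simp only: R Gx Gy prod.distrib cong: prod.cong) simp
  qed
  show ?thesis
  proof (rule summable_ratio_test[of "1/2" N])
    fix k assume "N \<le> k"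
    then show "norm (norm (?W (Suc k))) \<le> 1 / 2 * norm (norm (?W k))"
      unfolding step norm_mult real_norm_def abs_mult abs_norm_cancel
      by (intro mult_right_mono less_imp_le[OF N]) auto
  qed simp
qed

subsection \<open>Coefficients of the normalized vectors\<close>

text \<open>The Laurent coefficient of \<open>weight\<close> at z^(-k-1), that is, the value of its
  contour functional on z^k.\<close>

definition moment :: "nat \<Rightarrow> nat \<Rightarrow> (nat \<Rightarrow> complex) \<Rightarrow> (nat \<Rightarrow> complex) \<Rightarrow> (nat \<Rightarrow> complex) \<Rightarrow>
    nat \<Rightarrow> nat \<Rightarrow> nat \<Rightarrow> complex" where
  "moment q r a b \<kappa> j i k =
     (\<Prod>\<rho>=1..r. Gamma (of_nat k + \<kappa> i + a \<rho> + 1)) /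
     (\<Prod>h=1..q. Gamma (of_nat k + \<kappa> i + b h + of_bool (h = j) + 1))"

text \<open>The constant \<open>nuA\<close> is kept outside, to be combined with \<open>nuB\<close>
  and \<open>piB\<close> into the prefactor of the block.\<close>

definition coeffA :: "nat \<Rightarrow> nat \<Rightarrow> nat \<Rightarrow> (nat \<Rightarrow> complex) \<Rightarrow> (nat \<Rightarrow> complex) \<Rightarrow> (nat \<Rightarrow> complex) \<Rightarrow>
    (nat \<Rightarrow> nat) \<Rightarrow> (nat \<Rightarrow> nat) \<Rightarrow> nat \<Rightarrow> nat \<Rightarrow> complex" where
  "coeffA p q r a b \<kappa> n m i k =
     coefA p q r a b \<kappa> n m i *
     ((pochhammer (1 - of_nat (n i)) k *
       (\<Prod>h=1..q. pochhammer (\<kappa> i + b h + of_nat (m h) + 1) k) *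
       (\<Prod>l\<in>{1..p} - {i}. pochhammer (\<kappa> i - \<kappa> l - of_nat (n l) + 1) k)) /
      ((\<Prod>\<rho>=1..r. pochhammer (\<kappa> i + a \<rho> + 1) k) *
       (\<Prod>l\<in>{1..p} - {i}. pochhammer (\<kappa> i - \<kappa> l + 1) k)) / fact k)"

text \<open>What multiplies \<open>piB\<close> and z^k in the double sum of \<open>vecB\<close>: the
  part that depends on \<open>a\<close> and \<open>b\<close> but not on the multi-indices.\<close>

definition kernelB :: "nat \<Rightarrow> nat \<Rightarrow> (nat \<Rightarrow> complex) \<Rightarrow> (nat \<Rightarrow> complex) \<Rightarrow>
    nat \<Rightarrow> nat \<Rightarrow> nat \<Rightarrow> nat \<Rightarrow> complex" where
  "kernelB q r a b j H K k =
     (\<Prod>\<rho>=1..r. pochhammer (a \<rho> - b j) 1) / (\<Prod>h\<in>{1..q} - {j}. pochhammer (b h - b j) 1) *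
     ((\<Prod>h\<in>{1..q} - {j}. pochhammer (b h - (b H + of_nat K)) 1) /
      (\<Prod>\<rho>=1..r. pochhammer (a \<rho> - (b H + of_nat K)) 1)) *
     ((\<Prod>h=1..q. pochhammer (b h - (b H + of_nat K) + 1 - of_bool (h = j)) k) /
      (\<Prod>\<rho>=1..r. pochhammer (a \<rho> - (b H + of_nat K) + 1) k))"

text \<open>K starts at 0 here and at 1 in \<open>vecB\<close>. For K = 0 the condition admits only
  H = j and k = 0, which accounts for the separate summand of \<open>vecB\<close>.\<close>

definition coeffB :: "nat \<Rightarrow> nat \<Rightarrow> nat \<Rightarrow> (nat \<Rightarrow> complex) \<Rightarrow> (nat \<Rightarrow> complex) \<Rightarrow> (nat \<Rightarrow> complex) \<Rightarrow>
    (nat \<Rightarrow> nat) \<Rightarrow> (nat \<Rightarrow> nat) \<Rightarrow> nat \<Rightarrow> nat \<Rightarrow> complex" where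
  "coeffB p q r a b \<kappa> n m j k =
     (\<Sum>H=1..q. \<Sum>K<m H. if k < K + of_bool (H = j) then piB p q b \<kappa> n m H K * kernelB q r a b j H K k else 0)"

lemma vecA_polynomial:
  "vecA p q r a b \<kappa> n m i z = (\<Sum>k<n i. nuA p q r a b \<kappa> n m * coeffA p q r a b \<kappa> n m i k * z ^ k)"
proof -
  have "{0..n i - 1} = {..<n i}" if "n i \<noteq> 0" using that by auto
  then show ?thesis
    by (simp add: vecA_def coeffA_def sum_distrib_left mult_ac)
qed

lemma kernelB_origin:
  assumes "\<And>\<rho>. \<rho> \<in> {1..r} \<Longrightarrow> a \<rho> \<noteq> b j" "\<And>h. h \<in> {1..q} - {j} \<Longrightarrow> b h \<noteq> b j"
  shows "kernelB q r a b j j 0 0 = 1"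
  using assms by (simp add: kernelB_def)

lemma vecB_polynomial:
  assumes "near_diagonal q m" "j \<in> {1..q}"
    and a: "\<And>\<rho>. \<rho> \<in> {1..r} \<Longrightarrow> m j \<ge> 1 \<Longrightarrow> a \<rho> \<noteq> b j" and b: "\<And>h. h \<in> {1..q} - {j} \<Longrightarrow> b h \<noteq> b j"
  shows "vecB p q r a b \<kappa> n m j z =
         (\<Sum>k<m j. nuB p q r a b \<kappa> n m * coeffB p q r a b \<kappa> n m j k * z ^ k)"
proof (cases "m j = 0")
  case True
  then show ?thesis by (simp add: vecB_def)
next
  case False
  define f where "f = (\<lambda>H K k. piB p q b \<kappa> n m H K * kernelB q r a b j H K k * z ^ k)"
  define F where "F = (\<lambda>H K. \<Sum>k<K + of_bool (H = j). f H K k)"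
  \<comment> \<open>For H = j this is K < m_j. For other H, near-diagonality gives K < m_H \<le> m_j
    + 1.\<close>
  have bound: "K + of_bool (H = j) \<le> m j" if "H \<in> {1..q}" "K < m H" for H K
    using assms(1,2) that by (force simp: near_diagonal_def)
  \<comment> \<open>At K = 0 the sum over k is empty unless H = j, when it has the single term k = 0
    with kernel 1.\<close>
  have F0: "F H 0 = (if H = j then piB p q b \<kappa> n m j 0 else 0)" for H
    using False kernelB_origin[of r a b j q] a b by (auto simp: F_def f_def)
  have split: "(\<Sum>K<m H. F H K) = (if H = j then piB p q b \<kappa> n m j 0 else 0) + (\<Sum>K=1..m H - 1. F H K)" for H
  proof (cases "m H = 0")
    case True
    then show ?thesis using False by auto
  next
    case nz: False
    then have "{..<m H} = insert 0 {1..m H - 1}" by auto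
    then show ?thesis by (simp add: F0)
  qed
  define c where "c = (\<Prod>\<rho>=1..r. pochhammer (a \<rho> - b j) 1) / (\<Prod>h\<in>{1..q} - {j}. pochhammer (b h - b j) 1)"
  define G where "G = (\<lambda>H K. piB p q b \<kappa> n m H K *
          ((\<Prod>h\<in>{1..q} - {j}. pochhammer (b h - (b H + of_nat K)) 1) /
           (\<Prod>\<rho>=1..r. pochhammer (a \<rho> - (b H + of_nat K)) 1)) *
          (\<Sum>d=0..K - 1 + of_bool (j = H).
             (\<Prod>h=1..q. pochhammer (b h - (b H + of_nat K) + 1 - of_bool (h = j)) d) /
             (\<Prod>\<rho>=1..r. pochhammer (a \<rho> - (b H + of_nat K) + 1) d) * z ^ d))"
  have F: "F H K = c * G H K" if "K \<in> {1..m H - 1}" for H K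
  proof -
    \<comment> \<open>This uses K \<ge> 1; at K = 0 the truncated \<open>K - 1\<close> would admit
      an extra index.\<close>
    have "{0..K - 1 + of_bool (j = H)} = {..<K + of_bool (H = j)}" using that by auto
    then show ?thesis
      unfolding F_def f_def kernelB_def c_def G_def sum_distrib_left
      by (simp only:) (intro sum.cong refl, simp add: mult_ac)
  qed
  have "(\<Sum>H=1..q. \<Sum>K=1..m H - 1. F H K) = (\<Sum>H=1..q. \<Sum>K=1..m H - 1. c * G H K)"
    by (intro sum.cong refl F)
  also have "\<dots> = c * (\<Sum>H=1..q. \<Sum>K=1..m H - 1. G H K)"
    by (simp only: sum_distrib_left)
  finally have "vecB p q r a b \<kappa> n m j z =
        nuB p q r a b \<kappa> n m * (piB p q b \<kappa> n m j 0 + (\<Sum>H=1..q. \<Sum>K=1..m H - 1. F H K))"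
    using False by (simp only: vecB_def if_False c_def G_def)
  also have "piB p q b \<kappa> n m j 0 + (\<Sum>H=1..q. \<Sum>K=1..m H - 1. F H K) = (\<Sum>H=1..q. \<Sum>K<m H. F H K)"
    using assms(2) by (simp only: split sum.distrib) simp
  also have "\<dots> = (\<Sum>H=1..q. \<Sum>K<m H. \<Sum>k<m j. if k < K + of_bool (H = j) then f H K k else 0)"
  proof (intro sum.cong refl)
    fix H K assume "H \<in> {1..q}" "K \<in> {..<m H}"
    then have "{..<K + of_bool (H = j)} \<subseteq> {..<m j}" using bound[of H K] by auto
    then show "F H K = (\<Sum>k<m j. if k < K + of_bool (H = j) then f H K k else 0)"
      unfolding F_def by (intro sum.mono_neutral_cong_left) auto
  qed
  also have "\<dots> = (\<Sum>H=1..q. \<Sum>k<m j. \<Sum>K<m H. if k < K + of_bool (H = j) then f H K k else 0)"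
    by (intro sum.cong refl sum.swap)
  also have "\<dots> = (\<Sum>k<m j. \<Sum>H=1..q. \<Sum>K<m H. if k < K + of_bool (H = j) then f H K k else 0)"
    by (rule sum.swap)
  also have "\<dots> = (\<Sum>k<m j. coeffB p q r a b \<kappa> n m j k * z ^ k)"
    unfolding coeffB_def f_def sum_distrib_right
    by (intro sum.cong refl) auto
  finally show ?thesis
    by (simp add: sum_distrib_left mult_ac)
qed

section \<open>Cancellation of Pochhammer symbols and Gamma factors\<close>

text \<open>With x_h = b_h - b_H - K, the factor x_h joins (x_h+1)_\<beta> to (x_h)_{\<beta>+1} for
  h different from j, while h = j gives (x_j)_\<beta>. The component h = H has x_H = -K and turns
  into factorials, cancelling K!; the others are divided by (x_h)_{m_h} with
  \<open>ipoch_quotient\<close>.\<close>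

lemma kernelB_b_part:
  fixes b :: "nat \<Rightarrow> complex"
  assumes H: "H \<in> {1..q}" and reg: "\<And>h. h \<in> {1..q} - {H} \<Longrightarrow> b h - b H \<notin> \<int>"
    and j: "j \<in> {1..q}" and \<beta>: "\<beta> < K + of_bool (H = j)"
  defines "s \<equiv> \<beta> + of_bool (H \<noteq> j)"
  shows "(\<Prod>h\<in>{1..q} - {j}. pochhammer (b h - (b H + of_nat K)) 1) *
         (\<Prod>h=1..q. pochhammer (b h - (b H + of_nat K) + 1 - of_bool (h = j)) \<beta>) /
         (fact K * (\<Prod>I\<in>{1..q} - {H}. pochhammer (b I - b H - of_nat K) (m I))) =
         (- 1) ^ s / (fact (K - s) *
           (\<Prod>h\<in>{1..q} - {H}. ipoch (b h - (b H + of_nat K) + (of_nat \<beta> + 1) - of_bool (h = j))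
                                     (int (m h) - (int \<beta> + 1) + of_bool (h = j))))"
proof -
  define x where "x = (\<lambda>h. b h - (b H + of_nat K))"
  \<comment> \<open>The subscript of x_h after merging; in particular
    \<open>t H = s\<close>.\<close>
  define t where "t = (\<lambda>h. \<beta> + of_bool (h \<noteq> j))"
  \<comment> \<open>The bound on \<beta> says exactly this in both cases, H = j and H different from
    j.\<close>
  have sK: "s \<le> K" using \<beta> by (auto simp: s_def)
  have xnz: "pochhammer (x h) k \<noteq> 0" if "h \<in> {1..q} - {H}" for h k
  proof (rule pochhammer_nonzero_Ints)
    show "x h \<notin> \<int>"
      using reg[OF that] Ints_add[of "x h" "of_nat K"] by (auto simp: x_def)
  qed
  have "(\<Prod>h\<in>{1..q} - {j}. pochhammer (x h) 1) = (\<Prod>h=1..q. if h = j then 1 else x h)"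
    by (rule prod.mono_neutral_cong_left) auto
  then have "(\<Prod>h\<in>{1..q} - {j}. pochhammer (x h) 1) * (\<Prod>h=1..q. pochhammer (x h + 1 - of_bool (h = j)) \<beta>) =
        (\<Prod>h=1..q. (if h = j then 1 else x h) * pochhammer (x h + 1 - of_bool (h = j)) \<beta>)"
    by (simp only: prod.distrib)
  also have "\<dots> = (\<Prod>h=1..q. pochhammer (x h) (t h))"
    by (intro prod.cong) (auto simp: t_def pochhammer_rec)
  also have "\<dots> = pochhammer (x H) s * (\<Prod>h\<in>{1..q} - {H}. pochhammer (x h) (t h))"
    using H by (subst prod.remove[of _ H]) (auto simp: t_def s_def)
  also have "pochhammer (x H) s = (- 1) ^ s * fact K / fact (K - s)"
    using pochhammer_uminus_of_nat[OF sK] by (simp add: x_def)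
  finally have num: "(\<Prod>h\<in>{1..q} - {j}. pochhammer (x h) 1) * (\<Prod>h=1..q. pochhammer (x h + 1 - of_bool (h = j)) \<beta>) =
     (- 1) ^ s * fact K / fact (K - s) * (\<Prod>h\<in>{1..q} - {H}. pochhammer (x h) (t h))" .
  have "(\<Prod>h\<in>{1..q} - {H}. ipoch (x h + (of_nat \<beta> + 1) - of_bool (h = j))
                                     (int (m h) - (int \<beta> + 1) + of_bool (h = j))) =
        (\<Prod>h\<in>{1..q} - {H}. pochhammer (x h) (m h) / pochhammer (x h) (t h))"
  proof (rule prod.cong)
    fix h assume h: "h \<in> {1..q} - {H}"
    show "ipoch (x h + (of_nat \<beta> + 1) - of_bool (h = j)) (int (m h) - (int \<beta> + 1) + of_bool (h = j)) =
          pochhammer (x h) (m h) / pochhammer (x h) (t h)"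
      using ipoch_quotient[OF xnz[OF h, of "t h"] xnz[OF h, of "m h"]]
      by (cases "h = j") (simp_all add: t_def algebra_simps)
  qed simp
  also have "\<dots> = (\<Prod>h\<in>{1..q} - {H}. pochhammer (x h) (m h)) / (\<Prod>h\<in>{1..q} - {H}. pochhammer (x h) (t h))"
    by (rule prod_dividef)
  finally have den: "(\<Prod>h\<in>{1..q} - {H}. ipoch (x h + (of_nat \<beta> + 1) - of_bool (h = j))
                                     (int (m h) - (int \<beta> + 1) + of_bool (h = j))) =
       (\<Prod>h\<in>{1..q} - {H}. pochhammer (x h) (m h)) / (\<Prod>h\<in>{1..q} - {H}. pochhammer (x h) (t h))" .
  have nz: "(\<Prod>h\<in>{1..q} - {H}. pochhammer (x h) (m h)) \<noteq> 0" "(\<Prod>h\<in>{1..q} - {H}. pochhammer (x h) (t h)) \<noteq> 0"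
    using xnz by auto
  have xm: "b I - b H - of_nat K = x I" "b I - (b H + of_nat K) = x I" for I by (simp_all add: x_def)
  show ?thesis
    unfolding xm num den using nz by (simp add: field_simps)
qed

text \<open>The product separates into factors in \<open>a\<close>, in \<open>b\<close>, in \<kappa>
  alone, and factorials, and each group collapses on its own. For \<open>a\<close> it is
  Gamma(x+d+\<alpha>+\<beta>) / (Gamma(x) (x)_\<alpha>) = (x+\<alpha>)_{d+\<beta>}; for
  \<open>b\<close> it is Gamma(x) (x)_m (x+m)_\<alpha> = Gamma(x+m+\<alpha>).\<close>

lemma coeffA_moment:
  assumes i: "i \<in> {1..p}" and \<alpha>: "\<alpha> < n i"
    and reg: "\<And>l. l \<in> {1..p} - {i} \<Longrightarrow> \<kappa> i - \<kappa> l \<notin> \<int>"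
    and a: "\<And>\<rho>. \<rho> \<in> {1..r} \<Longrightarrow> \<kappa> i + a \<rho> + 1 \<notin> \<int>\<^sub>\<le>\<^sub>0"
    and b: "\<And>h. h \<in> {1..q} \<Longrightarrow> \<kappa> i + b h + 1 \<notin> \<int>\<^sub>\<le>\<^sub>0"
  shows "coeffA p q r a b \<kappa> n m i \<alpha> * moment q r a b \<kappa> j i (d + \<alpha> + \<beta>) =
     - ((- 1) ^ (\<Sum>l=1..p. n l) * (- 1) ^ n i * (- 1) ^ \<alpha> / (fact \<alpha> * fact (n i - 1 - \<alpha>)) *
        ((\<Prod>\<rho>=1..r. pochhammer (\<kappa> i + a \<rho> + (of_nat \<alpha> + 1)) (d + \<beta>)) /
         (\<Prod>l\<in>{1..p} - {i}. pochhammer (\<kappa> i - \<kappa> l - of_nat (n l) + (of_nat \<alpha> + 1)) (n l))) *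
        (\<Prod>h=1..q. ipoch (\<kappa> i + b h + (of_nat d + of_nat \<alpha> + of_nat \<beta> + 1) + of_bool (h = j))
                       (int (m h) - (int d + int \<beta>) - of_bool (h = j))))"
proof -
  let ?k = "d + \<alpha> + \<beta>"
  have a_part: "(\<Prod>\<rho>=1..r. Gamma (of_nat ?k + \<kappa> i + a \<rho> + 1)) /
        ((\<Prod>\<rho>=1..r. Gamma (\<kappa> i + a \<rho> + 1)) * (\<Prod>\<rho>=1..r. pochhammer (\<kappa> i + a \<rho> + 1) \<alpha>)) =
        (\<Prod>\<rho>=1..r. pochhammer (\<kappa> i + a \<rho> + (of_nat \<alpha> + 1)) (d + \<beta>))"
    unfolding prod.distrib[symmetric] prod_dividef[symmetric]
  proof (rule prod.cong)
    fix \<rho> assume \<rho>: "\<rho> \<in> {1..r}"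
    define x where "x = \<kappa> i + a \<rho> + 1"
    have x: "x \<notin> \<int>\<^sub>\<le>\<^sub>0" using a[OF \<rho>] by (simp add: x_def)
    have "Gamma (x + of_nat ?k) / (Gamma x * pochhammer x \<alpha>) = pochhammer (x + of_nat \<alpha>) (d + \<beta>)"
      using pochhammer_Gamma[OF x, of \<alpha>] pochhammer_Gamma[OF add_of_nat_nonpos_Ints[OF x, of \<alpha>], of "d + \<beta>"]
        x add_of_nat_nonpos_Ints[OF x, of \<alpha>] by (simp add: Gamma_eq_zero_iff add_ac)
    then show "Gamma (of_nat ?k + \<kappa> i + a \<rho> + 1) / (Gamma (\<kappa> i + a \<rho> + 1) * pochhammer (\<kappa> i + a \<rho> + 1) \<alpha>) =
        pochhammer (\<kappa> i + a \<rho> + (of_nat \<alpha> + 1)) (d + \<beta>)"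
      by (simp add: x_def add_ac)
  qed simp
  have b_part: "(\<Prod>h=1..q. Gamma (\<kappa> i + b h + 1)) * (\<Prod>h=1..q. pochhammer (\<kappa> i + b h + 1) (m h)) *
        (\<Prod>h=1..q. pochhammer (\<kappa> i + b h + of_nat (m h) + 1) \<alpha>) /
        (\<Prod>h=1..q. Gamma (of_nat ?k + \<kappa> i + b h + of_bool (h = j) + 1)) =
        (\<Prod>h=1..q. ipoch (\<kappa> i + b h + (of_nat d + of_nat \<alpha> + of_nat \<beta> + 1) + of_bool (h = j))
                       (int (m h) - (int d + int \<beta>) - of_bool (h = j)))"
    unfolding prod.distrib[symmetric] prod_dividef[symmetric]
  proof (rule prod.cong)
    fix h assume h: "h \<in> {1..q}"
    define x where "x = \<kappa> i + b h + 1"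
    define e :: nat where "e = of_bool (h = j)"
    have x: "x + of_nat k \<notin> \<int>\<^sub>\<le>\<^sub>0" for k
      using add_of_nat_nonpos_Ints[OF b[OF h]] by (simp add: x_def)
    then have x0: "x \<notin> \<int>\<^sub>\<le>\<^sub>0" by (metis add_0_right of_nat_0)
    \<comment> \<open>Adding \<alpha> to both terms of the subscript makes both Gamma arguments
      natural shifts of \<open>x\<close>, hence not poles.\<close>
    have "x + of_nat (?k + e) + of_int (int (m h + \<alpha>) - int (?k + e)) = x + of_nat (m h + \<alpha>)"
      by simp
    then have "ipoch (x + of_nat (?k + e)) (int (m h + \<alpha>) - int (?k + e)) =
          Gamma (x + of_nat (m h + \<alpha>)) / Gamma (x + of_nat (?k + e))"
      using x[of "m h + \<alpha>"] x[of "?k + e"] by (metis ipoch_Gamma)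
    also have "Gamma (x + of_nat (m h + \<alpha>)) = Gamma x * pochhammer x (m h) * pochhammer (x + of_nat (m h)) \<alpha>"
      using pochhammer_Gamma[OF x0, of "m h + \<alpha>"] x0 pochhammer_product'[of x "m h" \<alpha>]
      by (simp add: Gamma_eq_zero_iff field_simps)
    finally show "Gamma (\<kappa> i + b h + 1) * pochhammer (\<kappa> i + b h + 1) (m h) *
          pochhammer (\<kappa> i + b h + of_nat (m h) + 1) \<alpha> / Gamma (of_nat ?k + \<kappa> i + b h + of_bool (h = j) + 1) =
          ipoch (\<kappa> i + b h + (of_nat d + of_nat \<alpha> + of_nat \<beta> + 1) + of_bool (h = j))
                (int (m h) - (int d + int \<beta>) - of_bool (h = j))"
      by (simp add: x_def e_def algebra_simps)
  qed simp
  have \<kappa>_part: "(\<Prod>l\<in>{1..p} - {i}. pochhammer (\<kappa> i - \<kappa> l - of_nat (n l) + 1) \<alpha>) /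
        ((\<Prod>l\<in>{1..p} - {i}. pochhammer (\<kappa> i - \<kappa> l - of_nat (n l) + 1) (n l)) *
         (\<Prod>l\<in>{1..p} - {i}. pochhammer (\<kappa> i - \<kappa> l + 1) \<alpha>)) =
        1 / (\<Prod>l\<in>{1..p} - {i}. pochhammer (\<kappa> i - \<kappa> l - of_nat (n l) + (of_nat \<alpha> + 1)) (n l))"
    (is "_ = 1 / (\<Prod>l\<in>_. ?g l)")
  proof -
    have inv: "1 / (\<Prod>l\<in>{1..p} - {i}. ?g l) = (\<Prod>l\<in>{1..p} - {i}. 1 / ?g l)"
      by (simp add: prod_dividef)
    show ?thesis
      unfolding inv unfolding prod.distrib[symmetric] prod_dividef[symmetric]
    proof (rule prod.cong)
      fix l assume l: "l \<in> {1..p} - {i}"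
      define x where "x = \<kappa> i - \<kappa> l - of_nat (n l) + 1"
      have x: "x \<notin> \<int>"
      proof
        assume "x \<in> \<int>"
        then have "x + of_nat (n l) - 1 \<in> \<int>" by (intro Ints_add Ints_diff) auto
        then show False using reg[OF l] by (simp add: x_def)
      qed
      have x': "x + of_nat (n l) \<notin> \<int>"
        using x Ints_diff[of "x + of_nat (n l)" "of_nat (n l)"] by auto
      show "pochhammer (\<kappa> i - \<kappa> l - of_nat (n l) + 1) \<alpha> /
          (pochhammer (\<kappa> i - \<kappa> l - of_nat (n l) + 1) (n l) * pochhammer (\<kappa> i - \<kappa> l + 1) \<alpha>) =
          1 / pochhammer (\<kappa> i - \<kappa> l - of_nat (n l) + (of_nat \<alpha> + 1)) (n l)"
        using pochhammer_shift_quotient[OF pochhammer_nonzero_Ints[OF x, of "n l"]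
            pochhammer_nonzero_Ints[OF x', of \<alpha>] pochhammer_nonzero_Ints[OF x, of \<alpha>]]
        by (simp add: x_def algebra_simps)
    qed simp
  qed
  \<comment> \<open>The overall minus sign comes from replacing the exponent n_i - 1 by n_i, where
    n_i \<ge> 1 because \<alpha> < n_i.\<close>
  have fact_part: "pochhammer (1 - of_nat (n i)) \<alpha> / ((- 1) ^ (n i - 1) * fact (n i - 1)) =
        - ((- 1) ^ n i * (- 1) ^ \<alpha> / fact (n i - 1 - \<alpha>) :: complex)"
  proof -
    obtain k where k: "n i = Suc k" using \<alpha> by (cases "n i") auto
    then have "\<alpha> \<le> k" using \<alpha> by simp
    then show ?thesis using pochhammer_uminus_of_nat[of \<alpha> k, where 'a = complex]
      by (simp add: k field_simps)
  qed
  have "coeffA p q r a b \<kappa> n m i \<alpha> * moment q r a b \<kappa> j i ?k =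
    (- 1) ^ (\<Sum>l=1..p. n l) * (pochhammer (1 - of_nat (n i)) \<alpha> / ((- 1) ^ (n i - 1) * fact (n i - 1))) / fact \<alpha> *
    ((\<Prod>\<rho>=1..r. Gamma (of_nat ?k + \<kappa> i + a \<rho> + 1)) /
        ((\<Prod>\<rho>=1..r. Gamma (\<kappa> i + a \<rho> + 1)) * (\<Prod>\<rho>=1..r. pochhammer (\<kappa> i + a \<rho> + 1) \<alpha>))) *
    ((\<Prod>h=1..q. Gamma (\<kappa> i + b h + 1)) * (\<Prod>h=1..q. pochhammer (\<kappa> i + b h + 1) (m h)) *
        (\<Prod>h=1..q. pochhammer (\<kappa> i + b h + of_nat (m h) + 1) \<alpha>) /
        (\<Prod>h=1..q. Gamma (of_nat ?k + \<kappa> i + b h + of_bool (h = j) + 1))) *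
    ((\<Prod>l\<in>{1..p} - {i}. pochhammer (\<kappa> i - \<kappa> l - of_nat (n l) + 1) \<alpha>) /
        ((\<Prod>l\<in>{1..p} - {i}. pochhammer (\<kappa> i - \<kappa> l - of_nat (n l) + 1) (n l)) *
         (\<Prod>l\<in>{1..p} - {i}. pochhammer (\<kappa> i - \<kappa> l + 1) \<alpha>)))"
    unfolding coeffA_def coefA_def moment_def by (simp only: times_divide_eq_left times_divide_eq_right divide_divide_eq_left divide_divide_eq_right mult_ac)
  also have "\<dots> = - ((- 1) ^ (\<Sum>l=1..p. n l) * (- 1) ^ n i * (- 1) ^ \<alpha> / (fact \<alpha> * fact (n i - 1 - \<alpha>)) *
        ((\<Prod>\<rho>=1..r. pochhammer (\<kappa> i + a \<rho> + (of_nat \<alpha> + 1)) (d + \<beta>)) /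
         (\<Prod>l\<in>{1..p} - {i}. pochhammer (\<kappa> i - \<kappa> l - of_nat (n l) + (of_nat \<alpha> + 1)) (n l))) *
        (\<Prod>h=1..q. ipoch (\<kappa> i + b h + (of_nat d + of_nat \<alpha> + of_nat \<beta> + 1) + of_bool (h = j))
                       (int (m h) - (int d + int \<beta>) - of_bool (h = j))))"
    unfolding a_part b_part \<kappa>_part fact_part by (simp add: mult_ac)
  finally show ?thesis .
qed

text \<open>Since -1 is its own inverse, subtracted exponents become factors. The integer exponents
  in the signs of the block are split into natural powers this way.\<close>

lemma minus_one_powi_diff: "(- 1 :: complex) powi (x - y) = (- 1) powi x * (- 1) powi y"
  by (simp add: power_int_diff divide_inverse flip: power_int_inverse)

lemma minus_one_powi_add: "(- 1 :: complex) powi (x + y) = (- 1) powi x * (- 1) powi y"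
  by (simp add: power_int_add)

subsection \<open>The pairing block\<close>

text \<open>With \<open>s = \<beta> + [H \<noteq> j]\<close>, one expression covers both cases of \<open>\<S>\<close>.\<close>

definition block_term :: "nat \<Rightarrow> nat \<Rightarrow> nat \<Rightarrow> (nat \<Rightarrow> complex) \<Rightarrow> (nat \<Rightarrow> complex) \<Rightarrow> (nat \<Rightarrow> complex) \<Rightarrow>
    (nat \<Rightarrow> nat) \<Rightarrow> (nat \<Rightarrow> nat) \<Rightarrow> (nat \<Rightarrow> nat) \<Rightarrow> (nat \<Rightarrow> nat) \<Rightarrow>
    nat \<Rightarrow> nat \<Rightarrow> nat \<Rightarrow> nat \<Rightarrow> nat \<Rightarrow> nat \<Rightarrow> nat \<Rightarrow> complex" where
  "block_term p q r a b \<kappa> n m \<nu> \<mu> d i j H K \<alpha> \<beta> =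
     (let s = \<beta> + of_bool (H \<noteq> j) in
      (- 1) ^ (\<Sum>l=1..p. n l) * (- 1) ^ n i * (- 1) ^ \<alpha> * (- 1) ^ s * (- 1) ^ K /
      (fact \<alpha> * fact (n i - 1 - \<alpha>) * fact (K - s) * fact (\<mu> H - K - 1)) *
      (((\<Prod>\<rho>=1..r. pochhammer (a \<rho> - b j) 1) *
        (\<Prod>\<rho>=1..r. pochhammer (\<kappa> i + a \<rho> + (of_nat \<alpha> + 1)) (d + \<beta>))) /
       ((\<Prod>l\<in>{1..p} - {i}. pochhammer (\<kappa> i - \<kappa> l - of_nat (n l) + (of_nat \<alpha> + 1)) (n l)) *
        (\<Prod>\<rho>=1..r. pochhammer (a \<rho> - (b H + of_nat K)) (\<beta> + 1)))) *
      nu_ratio p q b \<kappa> \<nu> \<mu> H K *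
      ((\<Prod>h=1..q. ipoch (\<kappa> i + b h + (of_nat d + of_nat \<alpha> + of_nat \<beta> + 1) + of_bool (h = j))
                        (int (m h) - (int d + int \<beta>) - of_bool (h = j))) /
       ((\<Prod>h\<in>{1..q} - {j}. pochhammer (b h - b j) 1) *
        (\<Prod>h\<in>{1..q} - {H}.
           ipoch (b h - (b H + of_nat K) + (of_nat \<beta> + 1) - of_bool (h = j))
                 (int (\<mu> h) - (int \<beta> + 1) + of_bool (h = j))))))"

text \<open>For H different from j only notation changes, with s = \<beta> + 1. For H = j the
  factors in \<open>a\<close> look different, but with x = a - b_j - K both (x)_{\<beta>+1}
  (x+\<beta>+1)_{K-\<beta>} and (x)_K (x+K) are (x)_{K+1}, and x + K = a - b_j.\<close>

lemma blockS_eq_block_term: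
  fixes a b \<kappa> :: "nat \<Rightarrow> complex"
  assumes "\<alpha> < n i" "K < \<mu> H" "\<beta> < K + of_bool (H = j)"
    and a: "\<And>\<rho>. \<rho> \<in> {1..r} \<Longrightarrow> a \<rho> - b H - of_nat K \<notin> \<int>\<^sub>\<le>\<^sub>0"
  shows "blockS p q r a b \<kappa> n m \<nu> \<mu> d i j H K \<alpha> \<beta> = block_term p q r a b \<kappa> n m \<nu> \<mu> d i j H K \<alpha> \<beta>"
proof (cases "H = j")
  case True
  then have \<beta>: "\<beta> \<le> K" using assms by simp
  have a_part: "(\<Prod>\<rho>=1..r. pochhammer (a \<rho> - (b j + of_nat K) + (of_nat \<beta> + 1)) (K - \<beta>)) /
        (\<Prod>\<rho>=1..r. pochhammer (a \<rho> - (b j + of_nat K)) K) =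
        (\<Prod>\<rho>=1..r. pochhammer (a \<rho> - b j) 1) /
        (\<Prod>\<rho>=1..r. pochhammer (a \<rho> - (b j + of_nat K)) (\<beta> + 1))"
    unfolding prod_dividef[symmetric]
  proof (rule prod.cong)
    fix \<rho> assume \<rho>: "\<rho> \<in> {1..r}"
    define x where "x = a \<rho> - (b j + of_nat K)"
    have x: "x \<notin> \<int>\<^sub>\<le>\<^sub>0" using a[OF \<rho>] True by (simp add: x_def algebra_simps)
    have "pochhammer x (\<beta> + 1) * pochhammer (x + of_nat (\<beta> + 1)) (K - \<beta>) = pochhammer x K * pochhammer (x + of_nat K) 1"
      using \<beta> pochhammer_product'[of x "\<beta> + 1" "K - \<beta>"] pochhammer_product'[of x K 1] by simp
    moreover have "x + of_nat K = a \<rho> - b j" by (simp add: x_def)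
    ultimately show "pochhammer (a \<rho> - (b j + of_nat K) + (of_nat \<beta> + 1)) (K - \<beta>) / pochhammer (a \<rho> - (b j + of_nat K)) K =
          pochhammer (a \<rho> - b j) 1 / pochhammer (a \<rho> - (b j + of_nat K)) (\<beta> + 1)"
      unfolding x_def[symmetric]
      using pochhammer_nonzero_nonpos_Ints[OF x, of K] pochhammer_nonzero_nonpos_Ints[OF x, of "\<beta> + 1"]
      by (simp add: frac_eq_eq mult_ac add_ac)
  qed simp
  have sgn: "(- 1 :: complex) powi ((\<Sum>l=1..p. int (n l)) - int (n i) + int \<alpha> + int \<beta> - int K) =
      (- 1) ^ (\<Sum>l=1..p. n l) * (- 1) ^ n i * (- 1) ^ \<alpha> * (- 1) ^ \<beta> * (- 1) ^ K"
    unfolding of_nat_sum[symmetric] minus_one_powi_add minus_one_powi_diff power_int_of_nat ..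
  \<comment> \<open>The shift by e_j disappears because the index j is removed from the
    product.\<close>
  have bool: "(\<Prod>h\<in>{1..q} - {j}. ipoch (b h - (b j + of_nat K) + (of_nat \<beta> + 1) - of_bool (h = j))
                                 (int (\<mu> h) - (int \<beta> + 1) + of_bool (h = j))) =
              (\<Prod>h\<in>{1..q} - {j}. ipoch (b h - (b j + of_nat K) + (of_nat \<beta> + 1))
                                 (int (\<mu> h) - (int \<beta> + 1)))"
    by (rule prod.cong) auto
  have "blockS p q r a b \<kappa> n m \<nu> \<mu> d i j H K \<alpha> \<beta> = blockS_diag p q r a b \<kappa> n m \<nu> \<mu> d i j K \<alpha> \<beta>"
    using True assms \<beta> by (simp add: blockS_def)
  also have "\<dots> = (- 1) ^ (\<Sum>l=1..p. n l) * (- 1) ^ n i * (- 1) ^ \<alpha> * (- 1) ^ \<beta> * (- 1) ^ K /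
       (fact \<alpha> * fact (n i - 1 - \<alpha>) * fact (K - \<beta>) * fact (\<mu> j - K - 1)) *
     ((\<Prod>\<rho>=1..r. pochhammer (\<kappa> i + a \<rho> + (of_nat \<alpha> + 1)) (d + \<beta>)) /
      (\<Prod>l\<in>{1..p} - {i}. pochhammer (\<kappa> i - \<kappa> l - of_nat (n l) + (of_nat \<alpha> + 1)) (n l)) *
      ((\<Prod>\<rho>=1..r. pochhammer (a \<rho> - (b j + of_nat K) + (of_nat \<beta> + 1)) (K - \<beta>)) /
       (\<Prod>\<rho>=1..r. pochhammer (a \<rho> - (b j + of_nat K)) K))) *
     nu_ratio p q b \<kappa> \<nu> \<mu> j K *
     ((\<Prod>h=1..q. ipoch (\<kappa> i + b h + (of_nat d + of_nat \<alpha> + of_nat \<beta> + 1) + of_bool (h = j))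
                       (int (m h) - (int d + int \<beta>) - of_bool (h = j))) /
      ((\<Prod>h\<in>{1..q} - {j}. pochhammer (b h - b j) 1) *
       (\<Prod>h\<in>{1..q} - {j}. ipoch (b h - (b j + of_nat K) + (of_nat \<beta> + 1))
                                 (int (\<mu> h) - (int \<beta> + 1)))))"
    unfolding blockS_diag_def sgn by (simp only: times_divide_times_eq)
  also have "\<dots> = block_term p q r a b \<kappa> n m \<nu> \<mu> d i j H K \<alpha> \<beta>"
    unfolding a_part block_term_def Let_def True bool
    by (simp only: times_divide_times_eq mult_ac simp_thms of_bool_eq add_0_right)
  finally show ?thesis .
next
  case False
  have sgn: "(- 1 :: complex) powi ((\<Sum>l=1..p. int (n l)) - int (n i) + 1 + int \<alpha> + int K + int \<beta>) =
      (- 1) ^ (\<Sum>l=1..p. n l) * (- 1) ^ n i * (- 1) ^ \<alpha> * (- 1) ^ (\<beta> + 1) * (- 1) ^ K"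
    unfolding of_nat_sum[symmetric] minus_one_powi_add minus_one_powi_diff power_int_of_nat by simp
  have "K - 1 - \<beta> = K - (\<beta> + 1)" by simp
  then show ?thesis
    using False assms
    unfolding blockS_def blockS_off_def sgn block_term_def Let_def by simp
qed

text \<open>Apart from signs, \<open>blockN\<close> is \<open>nuA\<close> times the numerator of
  \<open>nuB\<close> after the factor (a - b_{j_+})_1 is cancelled; the \<kappa>-products left in
  \<open>nuB\<close> and \<open>piB\<close> form \<open>nu_ratio\<close>. Each of
  \<open>nuA\<close>, \<open>nuB\<close>, \<open>piB\<close> carries a minus sign, so one
  remains.\<close>

lemma normalization_product:
  assumes \<mu>: "vmax q \<mu> \<ge> 1"
    and a: "\<And>\<rho>. \<rho> \<in> {1..r} \<Longrightarrow> a \<rho> \<noteq> b (jmax q \<mu>)"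
  shows "nuA p q r a b \<kappa> n m * nuB p q r a b \<kappa> \<nu> \<mu> * piB p q b \<kappa> \<nu> \<mu> H K =
         - (blockN p q r a b \<kappa> n m \<mu> * nu_ratio p q b \<kappa> \<nu> \<mu> H K /
           ((- 1) ^ K * fact K * fact (\<mu> H - K - 1) *
            (\<Prod>I\<in>{1..q} - {H}. pochhammer (b I - b H - of_nat K) (\<mu> I))))"
proof -
  \<comment> \<open>This k is K_+; positivity of the maximum makes the subtraction on
    \<open>nat\<close> exact.\<close>
  obtain k where k: "vmax q \<mu> = Suc k" using \<mu> by (cases "vmax q \<mu>") auto
  define B where "B = b (jmax q \<mu>)"
  have "(\<Prod>\<rho>=1..r. pochhammer (a \<rho> - B - of_nat k) (Suc k)) =
        (\<Prod>\<rho>=1..r. pochhammer (a \<rho> - (B + of_nat k)) k) * (\<Prod>\<rho>=1..r. pochhammer (a \<rho> - B) 1)"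
    unfolding prod.distrib[symmetric]
    by (intro prod.cong refl) (simp add: pochhammer_rec' algebra_simps)
  moreover have "(\<Prod>\<rho>=1..r. pochhammer (a \<rho> - B) 1) \<noteq> 0"
    using a by (simp add: B_def)
  ultimately have R: "(\<Prod>\<rho>=1..r. pochhammer (a \<rho> - B - of_nat k) (Suc k)) / (\<Prod>\<rho>=1..r. pochhammer (a \<rho> - B) 1) =
      (\<Prod>\<rho>=1..r. pochhammer (a \<rho> - (B + of_nat k)) k)"
    by simp
  define D where "D = (\<Prod>h | h \<in> {1..q} \<and> h \<noteq> jmax q \<mu> \<and> \<mu> h = vmax q \<mu>. b h - b (jmax q \<mu>))"
  define P where "P = (\<Prod>l=1..p. pochhammer (\<kappa> l + (B + of_nat k + 1)) (\<nu> l))"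
  define Q where "Q = (\<Prod>l=1..p. pochhammer (\<kappa> l + (b H + of_nat K + 1)) (\<nu> l))"
  define X where "X = (\<Prod>\<rho>=1..r. pochhammer (a \<rho> - (B + of_nat k)) k)"
  have nuB: "nuB p q r a b \<kappa> \<nu> \<mu> = - (X * D / P)"
    unfolding nuB_def X_def R[symmetric] P_def D_def B_def[symmetric] k by (simp add: algebra_simps)
  have blockN: "blockN p q r a b \<kappa> n m \<mu> = - (nuA p q r a b \<kappa> n m * X * D)"
    unfolding nuA_def blockN_def Let_def D_def B_def[symmetric] k X_def
    by (simp add: algebra_simps)
  have "nu_ratio p q b \<kappa> \<nu> \<mu> H K = Q / P"
    unfolding nu_ratio_def Let_def Q_def P_def B_def k by simp
  moreover have "(\<Prod>i=1..p. pochhammer (\<kappa> i + b H + of_nat K + 1) (\<nu> i)) = Q"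
    unfolding Q_def by (simp add: algebra_simps)
  ultimately show ?thesis
    unfolding piB_def nuB blockN by (simp add: field_simps)
qed

text \<open>The normalizing constants, the kernel and the product with the moment are each known in
  closed form, so multiplying them yields \<open>block_term\<close>. The minus signs of
  \<open>normalization_product\<close> and \<open>coeffA_moment\<close> cancel.\<close>

lemma coeff_product_eq_block:
  fixes a b \<kappa> :: "nat \<Rightarrow> complex"
  assumes i: "i \<in> {1..p}" and j: "j \<in> {1..q}" and H: "H \<in> {1..q}"
    and \<alpha>: "\<alpha> < n i" and K: "K < \<mu> H" and \<beta>: "\<beta> < K + of_bool (H = j)" and \<mu>: "vmax q \<mu> \<ge> 1"
    and \<kappa>_reg: "\<And>l. l \<in> {1..p} - {i} \<Longrightarrow> \<kappa> i - \<kappa> l \<notin> \<int>"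
    and b_reg: "\<And>h. h \<in> {1..q} - {H} \<Longrightarrow> b h - b H \<notin> \<int>"
    and a: "\<And>\<rho>. \<rho> \<in> {1..r} \<Longrightarrow> \<kappa> i + a \<rho> + 1 \<notin> \<int>\<^sub>\<le>\<^sub>0"
    and b: "\<And>h. h \<in> {1..q} \<Longrightarrow> \<kappa> i + b h + 1 \<notin> \<int>\<^sub>\<le>\<^sub>0"
    and aK: "\<And>\<rho>. \<rho> \<in> {1..r} \<Longrightarrow> a \<rho> - b H - of_nat K \<notin> \<int>\<^sub>\<le>\<^sub>0"
    and a_max: "\<And>\<rho>. \<rho> \<in> {1..r} \<Longrightarrow> a \<rho> \<noteq> b (jmax q \<mu>)"
  shows "nuA p q r a b \<kappa> n m * coeffA p q r a b \<kappa> n m i \<alpha> *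
         (nuB p q r a b \<kappa> \<nu> \<mu> * (piB p q b \<kappa> \<nu> \<mu> H K * kernelB q r a b j H K \<beta>)) *
         moment q r a b \<kappa> j i (d + \<alpha> + \<beta>) =
         blockN p q r a b \<kappa> n m \<mu> * blockS p q r a b \<kappa> n m \<nu> \<mu> d i j H K \<alpha> \<beta>"
proof -
  define s where "s = \<beta> + of_bool (H \<noteq> j)"
  define Y where "Y = (\<Prod>I\<in>{1..q} - {H}. pochhammer (b I - b H - of_nat K) (\<mu> I))"
  define E where "E = (\<Prod>h\<in>{1..q} - {H}. ipoch (b h - (b H + of_nat K) + (of_nat \<beta> + 1) - of_bool (h = j))
                                     (int (\<mu> h) - (int \<beta> + 1) + of_bool (h = j)))"
  define B1 where "B1 = (\<Prod>h\<in>{1..q} - {j}. pochhammer (b h - (b H + of_nat K)) 1)"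
  define B2 where "B2 = (\<Prod>h=1..q. pochhammer (b h - (b H + of_nat K) + 1 - of_bool (h = j)) \<beta>)"
  define B0 where "B0 = (\<Prod>h\<in>{1..q} - {j}. pochhammer (b h - b j) 1)"
  define A0 where "A0 = (\<Prod>\<rho>=1..r. pochhammer (a \<rho> - b j) 1)"
  define A1 where "A1 = (\<Prod>\<rho>=1..r. pochhammer (a \<rho> - (b H + of_nat K)) (\<beta> + 1))"
  have A1: "(\<Prod>\<rho>=1..r. pochhammer (a \<rho> - (b H + of_nat K)) 1) * (\<Prod>\<rho>=1..r. pochhammer (a \<rho> - (b H + of_nat K) + 1) \<beta>) = A1"
    unfolding A1_def prod.distrib[symmetric] by (intro prod.cong refl) (simp add: pochhammer_rec)
  have kernel: "kernelB q r a b j H K \<beta> = A0 / B0 * (B1 * B2 / A1)"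
    unfolding kernelB_def A1[symmetric] A0_def B0_def B1_def B2_def by (simp add: mult_ac)
  have BP: "B1 * B2 / (fact K * Y) = (- 1) ^ s / (fact (K - s) * E)"
    unfolding B1_def B2_def Y_def E_def s_def by (rule kernelB_b_part[where b = b, OF H b_reg j \<beta>])
  define N where "N = blockN p q r a b \<kappa> n m \<mu>"
  define R where "R = nu_ratio p q b \<kappa> \<nu> \<mu> H K"
  define C where "C = coeffA p q r a b \<kappa> n m i \<alpha> * moment q r a b \<kappa> j i (d + \<alpha> + \<beta>)"
  note C = coeffA_moment[where p = p and q = q and r = r and i = i and a = a and b = b and \<kappa> = \<kappa> and
      n = n and m = m and j = j and \<alpha> = \<alpha> and d = d and \<beta> = \<beta>, folded C_def]
  \<comment> \<open>In \<open>piB\<close> the sign stands in the denominator, in the block in the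
    numerator.\<close>
  have sign: "1 / (- 1) ^ K = ((- 1) ^ K :: complex)"
    by (simp add: power_one_over[symmetric])
  have "nuA p q r a b \<kappa> n m * coeffA p q r a b \<kappa> n m i \<alpha> *
         (nuB p q r a b \<kappa> \<nu> \<mu> * (piB p q b \<kappa> \<nu> \<mu> H K * kernelB q r a b j H K \<beta>)) *
         moment q r a b \<kappa> j i (d + \<alpha> + \<beta>) =
        (nuA p q r a b \<kappa> n m * nuB p q r a b \<kappa> \<nu> \<mu> * piB p q b \<kappa> \<nu> \<mu> H K) * kernelB q r a b j H K \<beta> * C"
    by (simp add: C_def mult_ac)
  also have "nuA p q r a b \<kappa> n m * nuB p q r a b \<kappa> \<nu> \<mu> * piB p q b \<kappa> \<nu> \<mu> H K =
      - (N * R / ((- 1) ^ K * fact K * fact (\<mu> H - K - 1) * Y))"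
    unfolding N_def R_def Y_def by (rule normalization_product[where a = a and b = b, OF \<mu> a_max])
  also have "- (N * R / ((- 1) ^ K * fact K * fact (\<mu> H - K - 1) * Y)) * kernelB q r a b j H K \<beta> * C =
      - (N * R * (1 / (- 1) ^ K) / fact (\<mu> H - K - 1) * (A0 / (B0 * A1)) * (B1 * B2 / (fact K * Y)) * C)"
    unfolding kernel by (simp add: mult_ac)
  also have "\<dots> = - (N * R * (- 1) ^ K / fact (\<mu> H - K - 1) * (A0 / (B0 * A1)) * ((- 1) ^ s / (fact (K - s) * E)) * C)"
    unfolding BP sign ..
  also have "\<dots> = N * block_term p q r a b \<kappa> n m \<nu> \<mu> d i j H K \<alpha> \<beta>"
    unfolding block_term_def Let_def s_def[symmetric] E_def[symmetric] B0_def[symmetric]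
      A0_def[symmetric] A1_def[symmetric] R_def[symmetric]
    by (subst C) (use i \<alpha> \<kappa>_reg a b in \<open>auto simp: mult_ac\<close>)
  also have "block_term p q r a b \<kappa> n m \<nu> \<mu> d i j H K \<alpha> \<beta> = blockS p q r a b \<kappa> n m \<nu> \<mu> d i j H K \<alpha> \<beta>"
    by (rule blockS_eq_block_term[symmetric]) (fact \<alpha> K \<beta> aK)+
  finally show ?thesis
    unfolding N_def .
qed

section \<open>Pairings of polynomial vectors as sums of moments\<close>

lemma has_contour_integral_weight:
  fixes a b \<kappa> :: "nat \<Rightarrow> complex"
  assumes "r < q"
    and a: "\<And>\<rho>. \<rho> \<in> {1..r} \<Longrightarrow> \<kappa> i + a \<rho> + 1 \<notin> \<int>\<^sub>\<le>\<^sub>0"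
    and b: "\<And>h. h \<in> {1..q} \<Longrightarrow> \<kappa> i + b h + 1 \<notin> \<int>\<^sub>\<le>\<^sub>0"
  shows "((\<lambda>z. z ^ k * weight q r a b \<kappa> j i z) has_contour_integral
           2 * of_real pi * \<i> * moment q r a b \<kappa> j i k) (circlepath 0 1)"
proof -
  \<comment> \<open>The shift by e_j moves the argument by 0 or 1 to the right, which cannot reach a
    pole of Gamma.\<close>
  have "\<kappa> i + b h + of_bool (h = j) + 1 \<notin> \<int>\<^sub>\<le>\<^sub>0" if "h \<in> {1..q}" for h
    using add_of_nat_nonpos_Ints[OF b[OF that], of "of_bool (h = j)"] by (simp add: add_ac)
  then have "summable (\<lambda>k. norm (moment q r a b \<kappa> j i k))"
    using summable_Gamma_quotient[of r q "\<lambda>\<rho>. \<kappa> i + a \<rho> + 1" "\<lambda>h. \<kappa> i + b h + of_bool (h = j) + 1"] assms(1) a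
    by (simp add: moment_def add.assoc)
  then show ?thesis
    using has_contour_integral_Laurent[of "moment q r a b \<kappa> j i" k] by (simp add: weight_def moment_def)
qed

text \<open>By bilinearity only the contour integrals of monomials against the weights matter, and
  the factor z^d merely shifts the moment index.\<close>

lemma pairing_polynomials:
  fixes a b \<kappa> :: "nat \<Rightarrow> complex"
  assumes "r < q"
    and a: "\<And>i \<rho>. i \<in> {1..p} \<Longrightarrow> \<rho> \<in> {1..r} \<Longrightarrow> \<kappa> i + a \<rho> + 1 \<notin> \<int>\<^sub>\<le>\<^sub>0"
    and b: "\<And>i h. i \<in> {1..p} \<Longrightarrow> h \<in> {1..q} \<Longrightarrow> \<kappa> i + b h + 1 \<notin> \<int>\<^sub>\<le>\<^sub>0"
    and A: "\<And>i z. i \<in> {1..p} \<Longrightarrow> A i z = (\<Sum>\<alpha><n i. f i \<alpha> * z ^ \<alpha>)"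
    and B: "\<And>j z. j \<in> {1..q} \<Longrightarrow> B j z = (\<Sum>\<beta><m j. g j \<beta> * z ^ \<beta>)"
  shows "pairing p q r a b \<kappa> (\<lambda>j z. z ^ d * B j z) A =
         (\<Sum>j=1..q. \<Sum>i=1..p. \<Sum>\<beta><m j. \<Sum>\<alpha><n i. f i \<alpha> * g j \<beta> * moment q r a b \<kappa> j i (d + \<alpha> + \<beta>))"
  unfolding pairing_def
proof (intro sum.cong refl)
  fix i j assume j: "j \<in> {1..q}" and i: "i \<in> {1..p}"
  have "((\<lambda>z. \<Sum>\<beta><m j. \<Sum>\<alpha><n i. f i \<alpha> * g j \<beta> * (z ^ (d + \<alpha> + \<beta>) * weight q r a b \<kappa> j i z))
      has_contour_integral (\<Sum>\<beta><m j. \<Sum>\<alpha><n i. f i \<alpha> * g j \<beta> *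
         (2 * of_real pi * \<i> * moment q r a b \<kappa> j i (d + \<alpha> + \<beta>)))) (circlepath 0 1)"
    by (intro has_contour_integral_sum has_contour_integral_lmul has_contour_integral_weight finite_lessThan
          assms(1) a[OF i] b[OF i])
  moreover have "(\<Sum>\<beta><m j. \<Sum>\<alpha><n i. f i \<alpha> * g j \<beta> * (z ^ (d + \<alpha> + \<beta>) * weight q r a b \<kappa> j i z)) =
      z ^ d * B j z * weight q r a b \<kappa> j i z * A i z" for z
    unfolding A[OF i] B[OF j]
    by (simp add: sum_distrib_left sum_distrib_right power_add mult_ac)
  ultimately have "contour_integral (circlepath 0 1) (\<lambda>z. z ^ d * B j z * weight q r a b \<kappa> j i z * A i z) =
      (\<Sum>\<beta><m j. \<Sum>\<alpha><n i. f i \<alpha> * g j \<beta> * (2 * of_real pi * \<i> * moment q r a b \<kappa> j i (d + \<alpha> + \<beta>)))"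
    by (simp add: contour_integral_unique)
  also have "\<dots> = (2 * of_real pi * \<i>) * (\<Sum>\<beta><m j. \<Sum>\<alpha><n i. f i \<alpha> * g j \<beta> * moment q r a b \<kappa> j i (d + \<alpha> + \<beta>))"
    by (simp add: sum_distrib_left mult_ac)
  finally show "contour_integral (circlepath 0 1) (\<lambda>z. z ^ d * B j z * weight q r a b \<kappa> j i z * A i z) /
        (2 * of_real pi * \<i>) =
      (\<Sum>\<beta><m j. \<Sum>\<alpha><n i. f i \<alpha> * g j \<beta> * moment q r a b \<kappa> j i (d + \<alpha> + \<beta>))"
    by simp
qed

section \<open>Consequences of admissibility at the indices that occur\<close>

lemma jmax_mem:
  assumes "q \<ge> 1"
  shows "jmax q m \<in> {1..q}" "m (jmax q m) = vmax q m"
proof -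
  have "vmax q m \<in> m ` {1..q}" unfolding vmax_def using assms by (intro Max_in) auto
  then have "{j \<in> {1..q}. m j = vmax q m} \<noteq> {}" by auto
  then have "jmax q m \<in> {j \<in> {1..q}. m j = vmax q m}"
    unfolding jmax_def by (intro Min_in) auto
  then show "jmax q m \<in> {1..q}" "m (jmax q m) = vmax q m" by auto
qed

text \<open>Admissibility states the extreme case K = m_j - 1. A smaller K adds a natural number,
  and the complement of the nonpositive integers is closed under that.\<close>

lemma admissible_a_minus_b:
  assumes "admissible p q r a b \<kappa> m" "j \<in> {1..q}" "\<rho> \<in> {1..r}" "K < m j"
  shows "a \<rho> - b j - of_nat K \<notin> \<int>\<^sub>\<le>\<^sub>0"
proof -
  have "a \<rho> - b j - of_nat (m j) + 1 \<notin> \<int>\<^sub>\<le>\<^sub>0"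
    using assms by (auto simp: admissible_def)
  moreover obtain l where "m j = K + 1 + l"
    using assms(4) less_imp_add_positive[of K "m j"] by (auto simp: Suc_le_eq[symmetric] le_iff_add)
  ultimately show ?thesis
    using add_of_nat_nonpos_Ints[of "a \<rho> - b j - of_nat (m j) + 1" l] by (simp add: algebra_simps)
qed

section \<open>Comparison of the pairing with the block, term by term\<close>

theorem proposition7p2:
  fixes p q r d :: nat
    and a b \<kappa> :: "nat \<Rightarrow> complex"
    and \<nu> \<mu> lam \<eta> :: "nat \<Rightarrow> nat"
  assumes "p \<ge> 1" and "q \<ge> 1" and "r < q"
    and "regular p q b \<kappa>"
    and "(\<Sum>j=1..q. \<mu> j) = (\<Sum>i=1..p. \<nu> i) + 1"
    and "(\<Sum>i=1..p. lam i) = (\<Sum>j=1..q. \<eta> j) + 1"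
    and "near_diagonal q \<mu>" and "near_diagonal q \<eta>"
    and "admissible p q r a b \<kappa> \<mu>" and "admissible p q r a b \<kappa> \<eta>"
    and "d \<in> {0, 1}"
  shows "pairing_block p q r a b \<kappa> lam \<eta> \<nu> \<mu> d =
         pairing p q r a b \<kappa>
           (\<lambda>j z. z ^ d * vecB p q r a b \<kappa> \<nu> \<mu> j z)
           (vecA p q r a b \<kappa> lam \<eta>)"
proof -
  have b_reg: "b h - b j \<notin> \<int>" if "h \<in> {1..q} - {j}" "j \<in> {1..q}" for h j
    using \<open>regular p q b \<kappa>\<close> that by (auto simp: regular_def)
  have \<kappa>_reg: "\<kappa> i - \<kappa> l \<notin> \<int>" if "l \<in> {1..p} - {i}" "i \<in> {1..p}" for i l
    using \<open>regular p q b \<kappa>\<close> that by (auto simp: regular_def)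
  have a: "\<kappa> i + a \<rho> + 1 \<notin> \<int>\<^sub>\<le>\<^sub>0" if "i \<in> {1..p}" "\<rho> \<in> {1..r}" for i \<rho>
    using \<open>admissible p q r a b \<kappa> \<mu>\<close> that by (auto simp: admissible_def)
  have b: "\<kappa> i + b h + 1 \<notin> \<int>\<^sub>\<le>\<^sub>0" if "i \<in> {1..p}" "h \<in> {1..q}" for i h
    using \<open>admissible p q r a b \<kappa> \<mu>\<close> that by (auto simp: admissible_def)
  note aK = admissible_a_minus_b[OF \<open>admissible p q r a b \<kappa> \<mu>\<close>]
  have a_ne: "a \<rho> \<noteq> b j" if "j \<in> {1..q}" "\<rho> \<in> {1..r}" "\<mu> j \<ge> 1" for j \<rho>
    using aK[OF that(1,2), of 0] that(3) by auto
  \<comment> \<open>The size condition makes |\<mu>| = |\<nu>| + 1 positive, so \<mu> cannot vanish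
    identically.\<close>
  have vmax: "vmax q \<mu> \<ge> 1"
  proof (rule ccontr)
    assume "\<not> vmax q \<mu> \<ge> 1"
    moreover have "\<mu> j \<le> vmax q \<mu>" if "j \<in> {1..q}" for j
      unfolding vmax_def using that by (intro Max_ge) auto
    ultimately have "\<mu> j = 0" if "j \<in> {1..q}" for j
      using that by fastforce
    then show False using assms(5) by simp
  qed
  have a_max: "a \<rho> \<noteq> b (jmax q \<mu>)" if "\<rho> \<in> {1..r}" for \<rho>
    using a_ne[OF jmax_mem(1)[OF \<open>q \<ge> 1\<close>] that] jmax_mem(2)[OF \<open>q \<ge> 1\<close>, of \<mu>] vmax by simp
  let ?N = "blockN p q r a b \<kappa> lam \<eta> \<mu>"
  let ?fA = "\<lambda>i \<alpha>. nuA p q r a b \<kappa> lam \<eta> * coeffA p q r a b \<kappa> lam \<eta> i \<alpha>"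
  let ?w = "\<lambda>j i k. moment q r a b \<kappa> j i k"
  have "pairing p q r a b \<kappa> (\<lambda>j z. z ^ d * vecB p q r a b \<kappa> \<nu> \<mu> j z) (vecA p q r a b \<kappa> lam \<eta>) =
      (\<Sum>j=1..q. \<Sum>i=1..p. \<Sum>\<beta><\<mu> j. \<Sum>\<alpha><lam i. ?fA i \<alpha> *
         (nuB p q r a b \<kappa> \<nu> \<mu> * coeffB p q r a b \<kappa> \<nu> \<mu> j \<beta>) * ?w j i (d + \<alpha> + \<beta>))"
  proof (rule pairing_polynomials[OF \<open>r < q\<close> a b vecA_polynomial])
    fix j z assume j: "j \<in> {1..q}"
    show "vecB p q r a b \<kappa> \<nu> \<mu> j z =
        (\<Sum>\<beta><\<mu> j. nuB p q r a b \<kappa> \<nu> \<mu> * coeffB p q r a b \<kappa> \<nu> \<mu> j \<beta> * z ^ \<beta>)"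
    proof (rule vecB_polynomial[where a = a and b = b, OF \<open>near_diagonal q \<mu>\<close> j a_ne[OF j]])
      fix h assume "h \<in> {1..q} - {j}"
      then show "b h \<noteq> b j" using b_reg[of h j] j by auto
    qed
  qed
  also have "\<dots> = (\<Sum>j=1..q. \<Sum>i=1..p. \<Sum>\<beta><\<mu> j. \<Sum>\<alpha><lam i. ?N *
       (\<Sum>H=1..q. \<Sum>K<\<mu> H. blockS p q r a b \<kappa> lam \<eta> \<nu> \<mu> d i j H K \<alpha> \<beta>))"
  proof (intro sum.cong refl)
    fix j i \<beta> \<alpha>
    assume j: "j \<in> {1..q}" and i: "i \<in> {1..p}" and "\<beta> \<in> {..<\<mu> j}" and \<alpha>: "\<alpha> \<in> {..<lam i}"
    have "?fA i \<alpha> * (nuB p q r a b \<kappa> \<nu> \<mu> * coeffB p q r a b \<kappa> \<nu> \<mu> j \<beta>) * ?w j i (d + \<alpha> + \<beta>) =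
        (\<Sum>H=1..q. \<Sum>K<\<mu> H. ?fA i \<alpha> * (nuB p q r a b \<kappa> \<nu> \<mu> *
           (if \<beta> < K + of_bool (H = j) then piB p q b \<kappa> \<nu> \<mu> H K * kernelB q r a b j H K \<beta> else 0)) *
           ?w j i (d + \<alpha> + \<beta>))"
      unfolding coeffB_def sum_distrib_left sum_distrib_right ..
    also have "\<dots> = (\<Sum>H=1..q. \<Sum>K<\<mu> H. ?N * blockS p q r a b \<kappa> lam \<eta> \<nu> \<mu> d i j H K \<alpha> \<beta>)"
    proof (intro sum.cong refl)
      fix H K assume H: "H \<in> {1..q}" and K: "K \<in> {..<\<mu> H}"
      show "?fA i \<alpha> * (nuB p q r a b \<kappa> \<nu> \<mu> *
           (if \<beta> < K + of_bool (H = j) then piB p q b \<kappa> \<nu> \<mu> H K * kernelB q r a b j H K \<beta> else 0)) *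
           ?w j i (d + \<alpha> + \<beta>) = ?N * blockS p q r a b \<kappa> lam \<eta> \<nu> \<mu> d i j H K \<alpha> \<beta>"
      \<comment> \<open>This condition is the support of \<open>blockS\<close> in \<beta>: \<beta>
        \<le> K when H = j, and \<beta> < K otherwise, which forces K \<ge> 1. Outside it both sides
        are zero by definition.\<close>
      proof (cases "\<beta> < K + of_bool (H = j)")
        case True
        have "\<alpha> < lam i" "K < \<mu> H" using \<alpha> K by auto
        then show ?thesis
          using True coeff_product_eq_block[where a = a and b = b and \<kappa> = \<kappa> and n = lam and \<mu> = \<mu>,
              OF i j H _ _ True vmax \<kappa>_reg[OF _ i] b_reg[OF _ H] a[OF i] b[OF i] aK[OF H] a_max]
          by simp
      next
        case False
        then have "blockS p q r a b \<kappa> lam \<eta> \<nu> \<mu> d i j H K \<alpha> \<beta> = 0"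
          by (auto simp: blockS_def)
        then show ?thesis using False by simp
      qed
    qed
    finally show "?fA i \<alpha> * (nuB p q r a b \<kappa> \<nu> \<mu> * coeffB p q r a b \<kappa> \<nu> \<mu> j \<beta>) * ?w j i (d + \<alpha> + \<beta>) =
        ?N * (\<Sum>H=1..q. \<Sum>K<\<mu> H. blockS p q r a b \<kappa> lam \<eta> \<nu> \<mu> d i j H K \<alpha> \<beta>)"
      by (simp only: sum_distrib_left)
  qed
  also have "\<dots> = pairing_block p q r a b \<kappa> lam \<eta> \<nu> \<mu> d"
    unfolding pairing_block_def sum_distrib_left ..
  finally show ?thesis ..
qed

end
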